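(* Let $S$ be an inverse semigroup with zero, let $T$ be a generalized Boolean inverse semigroup, and let $\pi:S\to T$ be a representation of $S$ in $T$ (that is, a semigroup homomorphism preserving zero). Then: (i) if $\pi$ is tight then it is also cover-to-join; (ii) if $\pi$ is cover-to-join then there exists a generalized Boolean inverse sub-semigroup $T'$ of $T$, containing the range of $\pi$, such that, once $\pi$ is seen as a representation of $S$ in $T'$, one has that $\pi$ is tight; (iii) if $\pi$ is cover-to-join, and if the restriction of $\pi$ to $E(S)$ is non-degenerate (as a representation of $E(S)$ in $E(T)$), then $\pi$ is tight.
   Context: All inverse semigroups have a zero. $E(S)$ denotes the idempotent semilattice of an inverse semigroup $S$, with $e\wedge f=ef$ and $e\leq f\Leftrightarrow ef=e$. A generalized Boolean algebra is a set $B$ with binary operations $\wedge,\vee$ and an element $0$ such that for all $a,b,c\in B$: $\wedge$ and $\vee$ are commutative; $(a\wedge b)\wedge c=a\wedge(b\wedge c)$; $a\wedge(b\vee c)=(a\wedge b)\vee(a\wedge c)$; $a\vee 0=a$; if $a=a\wedge b$ (written $a\leq b$) there is $x\in B$ with $x\vee a=b$ and $x\wedge a=0$ (the relative complement, denoted $b\setminus a$); and $a\vee a=a=a\wedge a$. It is a Boolean algebra if there is $1\in B$ with $a\wedge 1=a$ for all $a\in B$; then $\neg a:=1\setminus a$. A generalized Boolean inverse semigroup is an inverse semigroup whose idempotent semilattice is a generalized Boolean algebra. A generalized Boolean inverse sub-semigroup of $T$ is an inverse sub-semigroup of $T$ that is itself a generalized Boolean inverse semigroup. Let $E$ be a semilattice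 with zero and $B$ a generalized Boolean algebra. We write $x\perp y$ when $x\wedge y=0$. A representation of $E$ in $B$ is a map $\pi:E\to B$ with $\pi(0)=0$ and $\pi(x\wedge y)=\pi(x)\wedge\pi(y)$. If $F\subseteq E$, a subset $Z\subseteq F$ is a cover for $F$ if for every nonzero $x\in F$ there is $z\in Z$ with $z\wedge x\neq 0$; "$E$ admits a finite cover" means there is a finite cover for $F=E$. For finite $X,Y\subseteq E$ put $E^{X,Y}=\{z\in E: z\leq x\ \forall x\in X,\ z\perp y\ \forall y\in Y\}$. Consider $$( * )\qquad \bigvee_{z\in Z}\pi(z)=\bigwedge_{x\in X}\pi(x)\wedge\bigwedge_{y\in Y}\neg\pi(y)$$ (empty join $=0$, empty meet $=1$). A representation $\pi$ of $E$ in $B$ is tight if either (a) $B$ is a Boolean algebra and $( * )$ holds for all finite $X,Y\subseteq E$ and every finite cover $Z$ for $E^{X,Y}$; or (b) $E$ admits no finite cover and $( * )$ holds for all finite $X,Y\subseteq E$ and every finite cover $Z$ for $E^{X,Y}$. In case (b) $X$ is necessarily nonempty whenever such a $Z$ exists, and the right-hand side of $( * )$ is interpreted via relative complements as $\big(\bigwedge_{x\in X}\pi(x)\big)\setminus\big(\bigwedge_{x\in X}\pi(x)\wedge\bigvee_{y\in Y}\pi(y)\big)$. A representation $\pi$ of $E$ in $B$ is cover-to-join if for every $x\in E$ and every finite cover $Z$ for $\{z\in E: z\leq x\}$ one has $\bigvee_{z\in Z}\pi(z)=\pi(x)$. It is non-degenerate if for every $a\in B$ there is a finite subset $Z\subseteq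 E$ with $a\leq\bigvee_{z\in Z}\pi(z)$. A zero-preserving homomorphism $\pi:S\to T$ from an inverse semigroup to a generalized Boolean inverse semigroup is called tight (respectively cover-to-join) if its restriction to $E(S)$ is a tight (respectively cover-to-join) representation of $E(S)$ in $E(T)$. *)

theory Defs
  imports "HOL-Algebra.FiniteProduct"
begin

record 'a semigroup_zero = "'a partial_object" +
  sprod :: "'a \<Rightarrow> 'a \<Rightarrow> 'a" (infixl "\<cdot>\<index>" 70)
  szero :: 'a ("\<zero>\<index>")

locale inverse_semigroup =
  fixes S (structure)
  assumes prod_closed [intro, simp]: "x \<in> carrier S \<Longrightarrow> y \<in> carrier S \<Longrightarrow> x \<cdot> y \<in> carrier S"
    and zero_closed [intro, simp]: "\<zero> \<in> carrier S"
    and prod_assoc: "x \<in> carrier S \<Longrightarrow> y \<in> carrier S \<Longrightarrow> z \<in> carrier S \<Longrightarrow>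
          (x \<cdot> y) \<cdot> z = x \<cdot> (y \<cdot> z)"
    and zero_prod [simp]: "x \<in> carrier S \<Longrightarrow> \<zero> \<cdot> x = \<zero>"
    and prod_zero [simp]: "x \<in> carrier S \<Longrightarrow> x \<cdot> \<zero> = \<zero>"
    and ex1_inverse: "x \<in> carrier S \<Longrightarrow>
          \<exists>!y. y \<in> carrier S \<and> x \<cdot> y \<cdot> x = x \<and> y \<cdot> x \<cdot> y = y"

definition sinv :: "('a, 'm) semigroup_zero_scheme \<Rightarrow> 'a \<Rightarrow> 'a" where
  "sinv S x = (THE y. y \<in> carrier S \<and> x \<cdot>\<^bsub>S\<^esub> y \<cdot>\<^bsub>S\<^esub> x = x \<and> y \<cdot>\<^bsub>S\<^esub> x \<cdot>\<^bsub>S\<^esub> y = y)"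

definition idempotents :: "('a, 'm) semigroup_zero_scheme \<Rightarrow> 'a set" where
  "idempotents S = {e \<in> carrier S. e \<cdot>\<^bsub>S\<^esub> e = e}"

text \<open>A semilattice with zero is written as a \<open>semigroup_zero\<close> structure whose product is the meet.\<close>

definition idem_semilattice :: "('a, 'm) semigroup_zero_scheme \<Rightarrow> 'a semigroup_zero" where
  "idem_semilattice S = \<lparr>carrier = idempotents S, sprod = sprod S, szero = szero S\<rparr>"

definition sleq :: "('a, 'm) semigroup_zero_scheme \<Rightarrow> 'a \<Rightarrow> 'a \<Rightarrow> bool" where
  "sleq E a b \<longleftrightarrow> a = a \<cdot>\<^bsub>E\<^esub> b"


text \<open>In a generalized Boolean algebra the product \<open>\<cdot>\<close> is the meet and
  \<open>sjoin\<close> is the join.\<close>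

record 'a gen_bool = "'a semigroup_zero" +
  sjoin :: "'a \<Rightarrow> 'a \<Rightarrow> 'a" (infixl "\<curlyvee>\<index>" 65)

locale generalized_boolean_algebra =
  fixes B (structure)
  assumes meet_closed [intro, simp]: "a \<in> carrier B \<Longrightarrow> b \<in> carrier B \<Longrightarrow> a \<cdot> b \<in> carrier B"
    and join_closed [intro, simp]: "a \<in> carrier B \<Longrightarrow> b \<in> carrier B \<Longrightarrow> a \<curlyvee> b \<in> carrier B"
    and zero_closed [intro, simp]: "\<zero> \<in> carrier B"
    and meet_commute: "a \<in> carrier B \<Longrightarrow> b \<in> carrier B \<Longrightarrow> a \<cdot> b = b \<cdot> a"
    and join_commute: "a \<in> carrier B \<Longrightarrow> b \<in> carrier B \<Longrightarrow> a \<curlyvee> b = b \<curlyvee> a"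
    and meet_assoc: "a \<in> carrier B \<Longrightarrow> b \<in> carrier B \<Longrightarrow> c \<in> carrier B \<Longrightarrow>
          (a \<cdot> b) \<cdot> c = a \<cdot> (b \<cdot> c)"
    and meet_join_distrib: "a \<in> carrier B \<Longrightarrow> b \<in> carrier B \<Longrightarrow> c \<in> carrier B \<Longrightarrow>
          a \<cdot> (b \<curlyvee> c) = (a \<cdot> b) \<curlyvee> (a \<cdot> c)"
    and join_zero [simp]: "a \<in> carrier B \<Longrightarrow> a \<curlyvee> \<zero> = a"
    and ex_relcomp: "a \<in> carrier B \<Longrightarrow> b \<in> carrier B \<Longrightarrow> a = a \<cdot> b \<Longrightarrow>
          \<exists>x \<in> carrier B. x \<curlyvee> a = b \<and> x \<cdot> a = \<zero>"
    and join_idem [simp]: "a \<in> carrier B \<Longrightarrow> a \<curlyvee> a = a"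
    and meet_idem [simp]: "a \<in> carrier B \<Longrightarrow> a \<cdot> a = a"

definition is_unit :: "('a, 'm) gen_bool_scheme \<Rightarrow> 'a \<Rightarrow> bool" where
  "is_unit B u \<longleftrightarrow> u \<in> carrier B \<and> (\<forall>a \<in> carrier B. a \<cdot>\<^bsub>B\<^esub> u = a)"

definition boolean_alg :: "('a, 'm) gen_bool_scheme \<Rightarrow> bool" where
  "boolean_alg B \<longleftrightarrow> generalized_boolean_algebra B \<and> (\<exists>u. is_unit B u)"

definition unit_of :: "('a, 'm) gen_bool_scheme \<Rightarrow> 'a" where
  "unit_of B = (THE u. is_unit B u)"

text \<open>\<open>relcomp B b a\<close> is the relative complement of \<open>a\<close> in \<open>b\<close>, meaningful when \<open>a \<le> b\<close>.\<close>

definition relcomp :: "('a, 'm) gen_bool_scheme \<Rightarrow> 'a \<Rightarrow> 'a \<Rightarrow> 'a" where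
  "relcomp B b a = (THE x. x \<in> carrier B \<and> x \<curlyvee>\<^bsub>B\<^esub> a = b \<and> x \<cdot>\<^bsub>B\<^esub> a = \<zero>\<^bsub>B\<^esub>)"

definition neg :: "('a, 'm) gen_bool_scheme \<Rightarrow> 'a \<Rightarrow> 'a" where
  "neg B a = relcomp B (unit_of B) a"

definition fin_join :: "('b, 'm) gen_bool_scheme \<Rightarrow> ('a \<Rightarrow> 'b) \<Rightarrow> 'a set \<Rightarrow> 'b" where
  "fin_join B f Z = finprod \<lparr>carrier = carrier B, monoid.mult = sjoin B, one = szero B\<rparr> f Z"

text \<open>Without a unit, a nonempty meet has no neutral element to start from, so the fold starts
  at one of the values being met; by idempotence that value may be met again.
  The empty meet is the unit, if there is one.\<close>

definition fin_meet :: "('b, 'm) gen_bool_scheme \<Rightarrow> ('a \<Rightarrow> 'b) \<Rightarrow> 'a set \<Rightarrow> 'b" where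
  "fin_meet B f X = foldD (carrier B) (\<lambda>x b. f x \<cdot>\<^bsub>B\<^esub> b)
     (if X = {} then unit_of B else f (SOME x. x \<in> X)) X"


text \<open>The join on the idempotents of \<open>T\<close> is not part of the data of \<open>T\<close>. It is determined by the
  meet (see \<open>sjoin_unique\<close> below), so that the choice made in \<open>idem_algebra\<close> is harmless.\<close>

definition idem_with_join :: "('a, 'm) semigroup_zero_scheme \<Rightarrow> ('a \<Rightarrow> 'a \<Rightarrow> 'a) \<Rightarrow> 'a gen_bool" where
  "idem_with_join T j =
     \<lparr>carrier = idempotents T, sprod = sprod T, szero = szero T, sjoin = j\<rparr>"

definition generalized_boolean_inverse_semigroup ::
    "('a, 'm) semigroup_zero_scheme \<Rightarrow> bool" where
  "generalized_boolean_inverse_semigroup T \<longleftrightarrow>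
     inverse_semigroup T \<and> (\<exists>j. generalized_boolean_algebra (idem_with_join T j))"

definition idem_algebra :: "('a, 'm) semigroup_zero_scheme \<Rightarrow> 'a gen_bool" where
  "idem_algebra T =
     idem_with_join T (SOME j. generalized_boolean_algebra (idem_with_join T j))"

definition inverse_subsemigroup :: "'a set \<Rightarrow> ('a, 'm) semigroup_zero_scheme \<Rightarrow> bool" where
  "inverse_subsemigroup H T \<longleftrightarrow> H \<subseteq> carrier T \<and> \<zero>\<^bsub>T\<^esub> \<in> H \<and>
     (\<forall>x \<in> H. \<forall>y \<in> H. x \<cdot>\<^bsub>T\<^esub> y \<in> H) \<and> (\<forall>x \<in> H. sinv T x \<in> H)"

definition generalized_boolean_inverse_subsemigroup ::
    "'a set \<Rightarrow> ('a, 'm) semigroup_zero_scheme \<Rightarrow> bool" where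
  "generalized_boolean_inverse_subsemigroup H T \<longleftrightarrow>
     inverse_subsemigroup H T \<and> generalized_boolean_inverse_semigroup (T\<lparr>carrier := H\<rparr>)"


definition semilattice_rep ::
    "('a, 'm) semigroup_zero_scheme \<Rightarrow> ('b, 'n) gen_bool_scheme \<Rightarrow> ('a \<Rightarrow> 'b) \<Rightarrow> bool" where
  "semilattice_rep E B \<pi> \<longleftrightarrow> \<pi> \<in> carrier E \<rightarrow> carrier B \<and> \<pi> \<zero>\<^bsub>E\<^esub> = \<zero>\<^bsub>B\<^esub> \<and>
     (\<forall>x \<in> carrier E. \<forall>y \<in> carrier E. \<pi> (x \<cdot>\<^bsub>E\<^esub> y) = \<pi> x \<cdot>\<^bsub>B\<^esub> \<pi> y)"

definition finite_cover :: "('a, 'm) semigroup_zero_scheme \<Rightarrow> 'a set \<Rightarrow> 'a set \<Rightarrow> bool" where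
  "finite_cover E F Z \<longleftrightarrow> finite Z \<and> Z \<subseteq> F \<and>
     (\<forall>x \<in> F. x \<noteq> \<zero>\<^bsub>E\<^esub> \<longrightarrow> (\<exists>z \<in> Z. z \<cdot>\<^bsub>E\<^esub> x \<noteq> \<zero>\<^bsub>E\<^esub>))"

definition below_perp ::
    "('a, 'm) semigroup_zero_scheme \<Rightarrow> 'a set \<Rightarrow> 'a set \<Rightarrow> 'a set" where
  "below_perp E X Y =
     {z \<in> carrier E. (\<forall>x \<in> X. sleq E z x) \<and> (\<forall>y \<in> Y. z \<cdot>\<^bsub>E\<^esub> y = \<zero>\<^bsub>E\<^esub>)}"

text \<open>In the second disjunct the sets \<open>X\<close> that matter are nonempty
  (see \<open>finite_cover_below_perp_empty\<close> below).\<close>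

definition tight_rep ::
    "('a, 'm) semigroup_zero_scheme \<Rightarrow> ('b, 'n) gen_bool_scheme \<Rightarrow> ('a \<Rightarrow> 'b) \<Rightarrow> bool" where
  "tight_rep E B \<pi> \<longleftrightarrow> semilattice_rep E B \<pi> \<and>
     (boolean_alg B \<and>
        (\<forall>X Y Z. finite X \<and> X \<subseteq> carrier E \<and> finite Y \<and> Y \<subseteq> carrier E \<and>
           finite_cover E (below_perp E X Y) Z \<longrightarrow>
             fin_join B \<pi> Z = fin_meet B \<pi> X \<cdot>\<^bsub>B\<^esub> fin_meet B (\<lambda>y. neg B (\<pi> y)) Y)
      \<or>
      (\<nexists>Z. finite_cover E (carrier E) Z) \<and>
        (\<forall>X Y Z. finite X \<and> X \<subseteq> carrier E \<and> finite Y \<and> Y \<subseteq> carrier E \<and>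
           finite_cover E (below_perp E X Y) Z \<longrightarrow>
             fin_join B \<pi> Z =
               relcomp B (fin_meet B \<pi> X) (fin_meet B \<pi> X \<cdot>\<^bsub>B\<^esub> fin_join B \<pi> Y)))"

definition cover_to_join_rep ::
    "('a, 'm) semigroup_zero_scheme \<Rightarrow> ('b, 'n) gen_bool_scheme \<Rightarrow> ('a \<Rightarrow> 'b) \<Rightarrow> bool" where
  "cover_to_join_rep E B \<pi> \<longleftrightarrow> semilattice_rep E B \<pi> \<and>
     (\<forall>x \<in> carrier E. \<forall>Z. finite_cover E {z \<in> carrier E. sleq E z x} Z \<longrightarrow>
        fin_join B \<pi> Z = \<pi> x)"

definition non_degenerate_rep ::
    "('a, 'm) semigroup_zero_scheme \<Rightarrow> ('b, 'n) gen_bool_scheme \<Rightarrow> ('a \<Rightarrow> 'b) \<Rightarrow> bool" where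
  "non_degenerate_rep E B \<pi> \<longleftrightarrow>
     (\<forall>a \<in> carrier B. \<exists>Z. finite Z \<and> Z \<subseteq> carrier E \<and> sleq B a (fin_join B \<pi> Z))"

definition semigroup_rep ::
    "('a, 'm) semigroup_zero_scheme \<Rightarrow> ('b, 'n) semigroup_zero_scheme \<Rightarrow> ('a \<Rightarrow> 'b) \<Rightarrow> bool" where
  "semigroup_rep S T \<pi> \<longleftrightarrow> \<pi> \<in> carrier S \<rightarrow> carrier T \<and> \<pi> \<zero>\<^bsub>S\<^esub> = \<zero>\<^bsub>T\<^esub> \<and>
     (\<forall>x \<in> carrier S. \<forall>y \<in> carrier S. \<pi> (x \<cdot>\<^bsub>S\<^esub> y) = \<pi> x \<cdot>\<^bsub>T\<^esub> \<pi> y)"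

definition tight ::
    "('a, 'm) semigroup_zero_scheme \<Rightarrow> ('b, 'n) semigroup_zero_scheme \<Rightarrow> ('a \<Rightarrow> 'b) \<Rightarrow> bool" where
  "tight S T \<pi> \<longleftrightarrow> semigroup_rep S T \<pi> \<and> tight_rep (idem_semilattice S) (idem_algebra T) \<pi>"

definition cover_to_join ::
    "('a, 'm) semigroup_zero_scheme \<Rightarrow> ('b, 'n) semigroup_zero_scheme \<Rightarrow> ('a \<Rightarrow> 'b) \<Rightarrow> bool" where
  "cover_to_join S T \<pi> \<longleftrightarrow>
     semigroup_rep S T \<pi> \<and> cover_to_join_rep (idem_semilattice S) (idem_algebra T) \<pi>"


context generalized_boolean_algebra
begin

lemma zero_meet: "a \<in> carrier B \<Longrightarrow> \<zero> \<cdot> a = \<zero>"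
  by (metis ex_relcomp meet_idem meet_assoc)

lemma join_absorb:
  assumes a: "a \<in> carrier B" and c: "c \<in> carrier B" and le: "c = c \<cdot> a"
  shows "a \<curlyvee> c = a"
proof -
  obtain d where d: "d \<in> carrier B" and dc: "d \<curlyvee> c = a" "d \<cdot> c = \<zero>"
    using ex_relcomp[OF c a le] by blast
  have da: "d \<cdot> a = d"
    using meet_join_distrib[OF d d c] dc d by simp
  have "a \<curlyvee> c = a \<cdot> (a \<curlyvee> c)"
    using meet_join_distrib[OF a a c] meet_commute[OF a c] le a by simp
  also have "\<dots> = (a \<curlyvee> c) \<cdot> (d \<curlyvee> c)"
    using dc meet_commute a c by simp
  also have "\<dots> = ((a \<curlyvee> c) \<cdot> d) \<curlyvee> ((a \<curlyvee> c) \<cdot> c)"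
    using meet_join_distrib a c d by simp
  also have "(a \<curlyvee> c) \<cdot> d = d"
    using meet_commute[of "a \<curlyvee> c" d] meet_join_distrib[OF d a c] da dc a c d by simp
  also have "(a \<curlyvee> c) \<cdot> c = c"
    using meet_commute[of "a \<curlyvee> c" c] meet_join_distrib[OF c a c] le a c by simp
  finally show ?thesis using dc by simp
qed

lemma sleq_join:
  assumes "a \<in> carrier B" "b \<in> carrier B"
  shows "sleq B a (a \<curlyvee> b)" "sleq B b (a \<curlyvee> b)"
proof -
  have *: "x = x \<cdot> (x \<curlyvee> y)" if "x \<in> carrier B" "y \<in> carrier B" for x y
    using meet_join_distrib[OF that(1) that(1) that(2)] that
      join_absorb[of x "x \<cdot> y"] by (metis meet_assoc meet_closed meet_commute meet_idem)
  show "sleq B a (a \<curlyvee> b)" "sleq B b (a \<curlyvee> b)"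
    using *[of a b] *[of b a] assms join_commute by (simp_all add: sleq_def)
qed

lemma join_least:
  assumes "a \<in> carrier B" "b \<in> carrier B" "u \<in> carrier B" "sleq B a u" "sleq B b u"
  shows "sleq B (a \<curlyvee> b) u"
  using assms meet_join_distrib[of u a b] meet_commute unfolding sleq_def
  by (metis join_closed)

lemma relcomp_unique:
  assumes "a \<in> carrier B"
    and "x \<in> carrier B" "x \<curlyvee> a = b" "x \<cdot> a = \<zero>" and "y \<in> carrier B" "y \<curlyvee> a = b" "y \<cdot> a = \<zero>"
  shows "x = y"
  using assms by (metis join_zero meet_commute meet_idem meet_join_distrib)

end

lemma sjoin_unique:
  assumes B: "generalized_boolean_algebra (idem_with_join T j)"
    and B': "generalized_boolean_algebra (idem_with_join T j')"
    and ab: "a \<in> idempotents T" "b \<in> idempotents T"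
  shows "j a b = j' a b"
proof -
  have c: "carrier (idem_with_join T k) = idempotents T" "sjoin (idem_with_join T k) = k"
    "sleq (idem_with_join T k) = sleq T" "sprod (idem_with_join T k) = sprod T" for k
    by (auto simp: idem_with_join_def sleq_def fun_eq_iff)
  interpret B: generalized_boolean_algebra "idem_with_join T j" by (fact B)
  interpret B': generalized_boolean_algebra "idem_with_join T j'" by (fact B')
  have "sleq T (j a b) (j' a b)" "sleq T (j' a b) (j a b)"
    using B.join_least[of a b "j' a b"] B'.join_least[of a b "j a b"]
      B.sleq_join[of a b] B'.sleq_join[of a b] B.join_closed[of a b] B'.join_closed[of a b] ab
    by (auto simp: c)
  then show ?thesis
    using B.meet_commute[of "j a b" "j' a b"] B.join_closed[of a b] B'.join_closed[of a b] ab
    by (simp add: c sleq_def)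
qed

lemma finite_cover_below_perp_empty:
  assumes "finite Y" "Y \<subseteq> carrier E" "finite_cover E (below_perp E {} Y) Z"
    and comm: "\<And>x y. x \<in> carrier E \<Longrightarrow> y \<in> carrier E \<Longrightarrow> x \<cdot>\<^bsub>E\<^esub> y = y \<cdot>\<^bsub>E\<^esub> x"
  shows "finite_cover E (carrier E) (Y \<union> Z)"
  using assms unfolding finite_cover_def below_perp_def by auto (metis Un_iff subsetD)

end

theory Submission
  imports Defs
begin

text \<open>
  Write \<open>x\<close> for the meet of a nonempty finite set \<open>X\<close>. If \<open>Z\<close> is a finite cover for \<open>E\<^sup>X\<^sup>,\<^sup>Y\<close>,
  then \<open>Z \<union> {x \<and> y | y \<in> Y}\<close> is a finite cover for the elements below \<open>x\<close>, so a cover-to-join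
  representation sends \<open>x\<close> to the disjoint join of \<open>\<Or>\<pi>(Z)\<close> and \<open>\<pi>(x) \<and> \<Or>\<pi>(Y)\<close>; this is tightness
  for \<open>X\<close> and \<open>Y\<close>. When \<open>X\<close> is empty, \<open>Z \<union> Y\<close> is a finite cover for \<open>E\<close>, and
  by non-degeneracy its image joins to a unit of the target. Non-degeneracy is achieved by
  restricting the target to the ideal \<open>I\<close> of \<open>E(T)\<close> generated by \<open>\<pi>(E(S))\<close> and \<open>T\<close> itself to the
  \<open>t\<close> with \<open>t = e t f\<close> for some \<open>e, f \<in> I\<close>.
\<close>

section \<open>Finite joins and meets in generalized Boolean algebras\<close>

lemma sleq_iff: "sleq E a b \<longleftrightarrow> a \<cdot>\<^bsub>E\<^esub> b = a"
  by (auto simp: sleq_def)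

context generalized_boolean_algebra
begin

lemma sleq_refl: "a \<in> carrier B \<Longrightarrow> sleq B a a"
  by (simp add: sleq_iff)

lemma sleq_antisym:
  "a \<in> carrier B \<Longrightarrow> b \<in> carrier B \<Longrightarrow> sleq B a b \<Longrightarrow> sleq B b a \<Longrightarrow> a = b"
  unfolding sleq_iff using meet_commute[of a b] by simp

lemma sleq_trans:
  "a \<in> carrier B \<Longrightarrow> b \<in> carrier B \<Longrightarrow> c \<in> carrier B \<Longrightarrow> sleq B a b \<Longrightarrow> sleq B b c \<Longrightarrow> sleq B a c"
  unfolding sleq_iff using meet_assoc[of a b c] by simp

lemma meet_sleq:
  assumes "a \<in> carrier B" "b \<in> carrier B"
  shows "sleq B (a \<cdot> b) a" "sleq B (a \<cdot> b) b"
  unfolding sleq_iff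
  using assms meet_assoc[of a b b] meet_commute[of "a \<cdot> b" a] meet_assoc[of a a b] by simp_all

lemma sleq_meet_iff:
  assumes "a \<in> carrier B" "b \<in> carrier B" "w \<in> carrier B"
  shows "sleq B w (a \<cdot> b) \<longleftrightarrow> sleq B w a \<and> sleq B w b"
proof
  show "sleq B w a \<and> sleq B w b" if "sleq B w (a \<cdot> b)"
    using that assms meet_sleq[of a b] sleq_trans[of w "a \<cdot> b" a] sleq_trans[of w "a \<cdot> b" b]
    by simp
  show "sleq B w (a \<cdot> b)" if "sleq B w a \<and> sleq B w b"
    unfolding sleq_iff using that assms meet_assoc[of w a b] by (simp add: sleq_iff)
qed

lemma join_sleq_iff:
  assumes "a \<in> carrier B" "b \<in> carrier B" "w \<in> carrier B"
  shows "sleq B (a \<curlyvee> b) w \<longleftrightarrow> sleq B a w \<and> sleq B b w"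
  using assms join_least[of a b w] sleq_join[of a b] sleq_trans[of a "a \<curlyvee> b" w]
    sleq_trans[of b "a \<curlyvee> b" w]
  by auto

lemma zero_sleq: "a \<in> carrier B \<Longrightarrow> sleq B \<zero> a"
  by (simp add: sleq_iff zero_meet)

lemma sleq_zero: "a \<in> carrier B \<Longrightarrow> sleq B a \<zero> \<Longrightarrow> a = \<zero>"
  using sleq_antisym[of a \<zero>] zero_sleq[of a] by simp

lemma meet_zero: "a \<in> carrier B \<Longrightarrow> a \<cdot> \<zero> = \<zero>"
  using meet_commute[of a \<zero>] by (simp add: zero_meet)

lemma meet_mono:
  assumes "a \<in> carrier B" "b \<in> carrier B" "c \<in> carrier B" "d \<in> carrier B"
    and "sleq B a c" "sleq B b d"
  shows "sleq B (a \<cdot> b) (c \<cdot> d)"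
proof -
  have "sleq B (a \<cdot> b) c" "sleq B (a \<cdot> b) d"
    using assms meet_sleq[of a b] sleq_trans[of "a \<cdot> b" a c] sleq_trans[of "a \<cdot> b" b d] by simp_all
  then show ?thesis using assms by (simp add: sleq_meet_iff)
qed

lemma disjoint_mono:
  assumes "a \<in> carrier B" "b \<in> carrier B" "c \<in> carrier B" "d \<in> carrier B"
    and "sleq B a c" "sleq B b d" "c \<cdot> d = \<zero>"
  shows "a \<cdot> b = \<zero>"
  using meet_mono[OF assms(1-6)] assms sleq_zero by simp

lemma zero_join: "a \<in> carrier B \<Longrightarrow> \<zero> \<curlyvee> a = a"
  using join_commute[of \<zero> a] by simp

text \<open>An element is determined by its upper bounds. Identities between joins are reduced in
  this way to equivalences of inequalities, which the universal property of joins decides.\<close>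

lemma sleq_cong:
  assumes "a \<in> carrier B" "b \<in> carrier B"
    and "\<And>w. w \<in> carrier B \<Longrightarrow> sleq B a w \<longleftrightarrow> sleq B b w"
  shows "a = b"
  using assms(3)[of a] assms(3)[of b] assms(1,2) by (simp add: sleq_refl sleq_antisym)

section \<open>Finite joins\<close>

lemma join_assoc:
  assumes "a \<in> carrier B" "b \<in> carrier B" "c \<in> carrier B"
  shows "(a \<curlyvee> b) \<curlyvee> c = a \<curlyvee> (b \<curlyvee> c)"
  by (rule sleq_cong) (use assms in \<open>auto simp: join_sleq_iff\<close>)

text \<open>Associativity of the join is not an axiom; it comes from comparing upper bounds. With
  it, \<open>fin_join\<close> is a finite product in a commutative monoid and inherits the rules of
  \<open>finprod\<close>.\<close>

lemma comm_monoid_join: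
  "comm_monoid \<lparr>carrier = carrier B, monoid.mult = sjoin B, one = szero B\<rparr>"
  by (rule comm_monoidI) (auto simp: join_assoc zero_join intro: join_commute)

lemma fin_join_empty [simp]: "fin_join B f {} = \<zero>"
  by (simp add: fin_join_def comm_monoid.finprod_empty[OF comm_monoid_join])

lemma fin_join_closed [simp]: "f \<in> Z \<rightarrow> carrier B \<Longrightarrow> fin_join B f Z \<in> carrier B"
  using comm_monoid.finprod_closed[OF comm_monoid_join, of f Z] by (simp add: fin_join_def)

lemma fin_join_insert:
  assumes "finite Z" "x \<notin> Z" "f \<in> insert x Z \<rightarrow> carrier B"
  shows "fin_join B f (insert x Z) = f x \<curlyvee> fin_join B f Z"
  using comm_monoid.finprod_insert[OF comm_monoid_join, of Z x f] assms
  by (simp add: fin_join_def)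

lemma fin_join_sleq_iff:
  assumes "finite Z" "f \<in> Z \<rightarrow> carrier B" "w \<in> carrier B"
  shows "sleq B (fin_join B f Z) w \<longleftrightarrow> (\<forall>z \<in> Z. sleq B (f z) w)"
  using assms
proof (induction rule: finite_induct)
  case empty
  then show ?case by (simp add: zero_sleq)
next
  case (insert x Z)
  then have "f x \<in> carrier B" "f \<in> Z \<rightarrow> carrier B" by auto
  then show ?case using insert by (simp add: fin_join_insert join_sleq_iff)
qed

lemma sleq_fin_join:
  "finite Z \<Longrightarrow> f \<in> Z \<rightarrow> carrier B \<Longrightarrow> z \<in> Z \<Longrightarrow> sleq B (f z) (fin_join B f Z)"
  using fin_join_sleq_iff[of Z f "fin_join B f Z"] sleq_refl by simp

text \<open>The sets may overlap: comparing upper bounds absorbs the repeated values, whereas the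
  product rule for disjoint unions would not apply.\<close>

lemma fin_join_Un:
  assumes "finite Y" "finite Z" "f \<in> Y \<union> Z \<rightarrow> carrier B"
  shows "fin_join B f (Y \<union> Z) = fin_join B f Y \<curlyvee> fin_join B f Z"
proof -
  have "f \<in> Y \<rightarrow> carrier B" "f \<in> Z \<rightarrow> carrier B"
    using assms by auto
  then show ?thesis
    by (intro sleq_cong) (use assms in \<open>auto simp: fin_join_sleq_iff join_sleq_iff\<close>)
qed

lemma meet_fin_join_distrib:
  assumes "finite Z" "f \<in> Z \<rightarrow> carrier B" "a \<in> carrier B"
  shows "a \<cdot> fin_join B f Z = fin_join B (\<lambda>z. a \<cdot> f z) Z"
  using assms
proof (induction rule: finite_induct)
  case empty
  then show ?case by (simp add: meet_zero)
next
  case (insert x Z)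
  then have "f x \<in> carrier B" "f \<in> Z \<rightarrow> carrier B" "(\<lambda>z. a \<cdot> f z) \<in> insert x Z \<rightarrow> carrier B"
    by auto
  then show ?case using insert by (simp add: fin_join_insert meet_join_distrib)
qed

lemma meet_fin_join_eq_zero:
  assumes "finite Z" "f \<in> Z \<rightarrow> carrier B" "a \<in> carrier B" "\<And>z. z \<in> Z \<Longrightarrow> a \<cdot> f z = \<zero>"
  shows "a \<cdot> fin_join B f Z = \<zero>"
proof -
  have "(\<lambda>z. a \<cdot> f z) \<in> Z \<rightarrow> carrier B"
    using assms by auto
  then have "sleq B (a \<cdot> fin_join B f Z) \<zero>"
    using assms by (simp add: meet_fin_join_distrib fin_join_sleq_iff sleq_refl)
  then show ?thesis
    using assms by (simp add: sleq_zero)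
qed

section \<open>Finite meets\<close>

lemma fold_meet:
  assumes "finite X" "f \<in> X \<rightarrow> carrier B" "e \<in> carrier B"
  defines "m \<equiv> foldD (carrier B) (\<lambda>x b. f x \<cdot> b) e X"
  shows "m \<in> carrier B" "\<And>w. w \<in> carrier B \<Longrightarrow> sleq B w m \<longleftrightarrow> sleq B w e \<and> (\<forall>x \<in> X. sleq B w (f x))"
proof -
  interpret LCD X "carrier B" "\<lambda>x b. f x \<cdot> b"
  proof
    show "f x \<cdot> (f y \<cdot> z) = f y \<cdot> (f x \<cdot> z)" if "x \<in> X" "y \<in> X" "z \<in> carrier B" for x y z
      using that assms(2) meet_assoc[of "f x" "f y" z] meet_assoc[of "f y" "f x" z]
        meet_commute[of "f x" "f y"] by (simp add: Pi_iff)
  qed (use assms(2) in auto)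
  \<comment> \<open>Left commutativity is available only for indices in the fixed set
    \<open>X\<close>, so the induction runs over finite \<open>Y\<close> and keeps
    \<open>Y \<subseteq> X\<close> as a premise.\<close>
  have "Y \<subseteq> X \<longrightarrow> foldD (carrier B) (\<lambda>x b. f x \<cdot> b) e Y \<in> carrier B \<and>
      (\<forall>w \<in> carrier B. sleq B w (foldD (carrier B) (\<lambda>x b. f x \<cdot> b) e Y) \<longleftrightarrow>
        sleq B w e \<and> (\<forall>x \<in> Y. sleq B w (f x)))" if "finite Y" for Y
    using that
  proof (induction rule: finite_induct)
    case empty
    then show ?case using assms(3) by simp
  next
    case (insert x Y)
    show ?case
    proof
      assume Y: "insert x Y \<subseteq> X"
      then have "foldD (carrier B) (\<lambda>x b. f x \<cdot> b) e (insert x Y)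
          = f x \<cdot> foldD (carrier B) (\<lambda>x b. f x \<cdot> b) e Y"
        using insert.hyps assms(3) by (intro foldD_insert) auto
      moreover have "f x \<in> carrier B"
        using Y assms(2) by auto
      ultimately show "foldD (carrier B) (\<lambda>x b. f x \<cdot> b) e (insert x Y) \<in> carrier B \<and>
          (\<forall>w \<in> carrier B. sleq B w (foldD (carrier B) (\<lambda>x b. f x \<cdot> b) e (insert x Y)) \<longleftrightarrow>
            sleq B w e \<and> (\<forall>x \<in> insert x Y. sleq B w (f x)))"
        using Y insert.IH by (auto simp: sleq_meet_iff)
    qed
  qed
  from this[OF assms(1)]
  show "m \<in> carrier B" "\<And>w. w \<in> carrier B \<Longrightarrow> sleq B w m \<longleftrightarrow> sleq B w e \<and> (\<forall>x \<in> X. sleq B w (f x))"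
    by (auto simp: m_def)
qed

text \<open>The fold starts at one of the values being met, so the lower-bound condition that
  \<open>fold_meet\<close> imposes for the start value is already one of the conditions for
  \<open>X\<close>.\<close>

lemma fin_meet_nonempty:
  assumes "finite X" "X \<noteq> {}" "f \<in> X \<rightarrow> carrier B"
  shows "fin_meet B f X \<in> carrier B"
    and "\<And>w. w \<in> carrier B \<Longrightarrow> sleq B w (fin_meet B f X) \<longleftrightarrow> (\<forall>x \<in> X. sleq B w (f x))"
proof -
  have x: "(SOME x. x \<in> X) \<in> X"
    using assms(2) by (simp add: some_in_eq)
  then have fx: "f (SOME x. x \<in> X) \<in> carrier B"
    using assms(3) by auto
  have eq: "fin_meet B f X = foldD (carrier B) (\<lambda>x b. f x \<cdot> b) (f (SOME x. x \<in> X)) X"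
    using assms(2) by (simp add: fin_meet_def)
  show "fin_meet B f X \<in> carrier B"
    unfolding eq by (rule fold_meet(1)[OF assms(1,3) fx])
  show "sleq B w (fin_meet B f X) \<longleftrightarrow> (\<forall>x \<in> X. sleq B w (f x))" if "w \<in> carrier B" for w
    unfolding eq fold_meet(2)[OF assms(1,3) fx that] using x by blast
qed

lemma fin_meet_eqI:
  assumes "finite X" "X \<noteq> {}" "f \<in> X \<rightarrow> carrier B" "a \<in> carrier B"
    and "\<And>w. w \<in> carrier B \<Longrightarrow> sleq B w a \<longleftrightarrow> (\<forall>x \<in> X. sleq B w (f x))"
  shows "fin_meet B f X = a"
proof (rule sleq_antisym)
  note m = fin_meet_nonempty[OF assms(1-3)]
  show "sleq B (fin_meet B f X) a"
    using m(1) m(2)[OF m(1)] assms(5)[OF m(1)] sleq_refl by simp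
  show "sleq B a (fin_meet B f X)"
    using m(2)[OF assms(4)] assms(5)[OF assms(4)] sleq_refl[OF assms(4)] by simp
qed (use assms(4) fin_meet_nonempty(1)[OF assms(1-3)] in auto)

lemma fin_meet_singleton: "f x \<in> carrier B \<Longrightarrow> fin_meet B f {x} = f x"
  by (rule fin_meet_eqI) auto

section \<open>Relative complements, units and negation\<close>

lemma relcomp_eqI:
  assumes "a \<in> carrier B" "x \<in> carrier B" "x \<curlyvee> a = b" "x \<cdot> a = \<zero>"
  shows "relcomp B b a = x"
  unfolding relcomp_def
proof (rule the_equality)
  show "y = x" if "y \<in> carrier B \<and> y \<curlyvee> a = b \<and> y \<cdot> a = \<zero>" for y
    using relcomp_unique[OF assms(1) _ _ _ assms(2-4)] that by simp
qed (use assms in simp)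

lemma unit_of_eq: "is_unit B u \<Longrightarrow> unit_of B = u"
  unfolding unit_of_def
  by (rule the_equality) (simp, metis is_unit_def meet_commute)

lemma fin_meet_empty: "is_unit B u \<Longrightarrow> fin_meet B f {} = u"
  by (simp add: fin_meet_def unit_of_eq) (simp add: is_unit_def foldD_empty)

text \<open>Let \<open>c\<close> be the complement of \<open>b\<close> in \<open>u\<close>.
  Distributing \<open>a\<close> over \<open>c \<curlyvee> b = u\<close> splits \<open>a\<close> into
  \<open>a \<cdot> c\<close> and \<open>a \<cdot> b\<close>; the first part is all of
  \<open>a\<close> exactly when the second vanishes.\<close>

lemma sleq_neg_iff:
  assumes u: "is_unit B u" and "a \<in> carrier B" "b \<in> carrier B"
  shows "neg B b \<in> carrier B" "sleq B a (neg B b) \<longleftrightarrow> a \<cdot> b = \<zero>"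
proof -
  have uc: "u \<in> carrier B" and au: "a \<cdot> u = a" and bu: "b = b \<cdot> u"
    using u assms by (auto simp: is_unit_def)
  obtain c where c: "c \<in> carrier B" "c \<curlyvee> b = u" "c \<cdot> b = \<zero>"
    using ex_relcomp[OF assms(3) uc bu] by blast
  have neg: "neg B b = c"
    using c assms by (simp add: neg_def unit_of_eq[OF u] relcomp_eqI)
  show "neg B b \<in> carrier B"
    using c neg by simp
  have "(a \<cdot> c) \<curlyvee> (a \<cdot> b) = a"
    using meet_join_distrib[of a c b] c assms au by simp
  then have "a \<cdot> c = a" if "a \<cdot> b = \<zero>"
    using that c assms by simp
  moreover have "a \<cdot> b = \<zero>" if "a \<cdot> c = a"
    using that c assms meet_assoc[of a c b] zero_meet meet_zero by simp
  ultimately show "sleq B a (neg B b) \<longleftrightarrow> a \<cdot> b = \<zero>"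
    unfolding neg sleq_iff by metis
qed

text \<open>A De Morgan argument: the elements below the meet of the complements are those disjoint
  from every \<open>f y\<close>. It converts a disjoint splitting of \<open>p\<close> into the
  right-hand side of the unital form of tightness.\<close>

lemma meet_fin_meet_neg:
  assumes u: "is_unit B u" and Y: "finite Y" "f \<in> Y \<rightarrow> carrier B"
    and p: "p \<in> carrier B" and j: "j \<in> carrier B"
    and split: "j \<curlyvee> (p \<cdot> fin_join B f Y) = p" and disj: "j \<cdot> fin_join B f Y = \<zero>"
  shows "p \<cdot> fin_meet B (\<lambda>y. neg B (f y)) Y = j"
\<comment> \<open>The empty meet is the unit by convention, whereas the order characterization of
  \<open>fin_meet\<close> is available for nonempty sets.\<close>
proof (cases "Y = {}")
  case True
  then show ?thesis
    using split p j u meet_zero[of p]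
    by (simp add: fin_meet_empty[OF u] is_unit_def)
next
  case False
  let ?m = "fin_meet B (\<lambda>y. neg B (f y)) Y" and ?q = "fin_join B f Y"
  have q: "?q \<in> carrier B" using Y by simp
  have "(\<lambda>y. neg B (f y)) \<in> Y \<rightarrow> carrier B"
    using Y sleq_neg_iff(1)[OF u p] by auto
  note m = fin_meet_nonempty[OF Y(1) False this]
  have m_iff: "sleq B w ?m \<longleftrightarrow> (\<forall>y \<in> Y. w \<cdot> f y = \<zero>)" if "w \<in> carrier B" for w
  proof -
    have "sleq B w (neg B (f y)) \<longleftrightarrow> w \<cdot> f y = \<zero>" if "y \<in> Y" for y
      using sleq_neg_iff(2)[OF u \<open>w \<in> carrier B\<close>, of "f y"] Y(2) that by auto
    then show ?thesis using m(2)[OF that] by simp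
  qed
  have jp: "sleq B j p"
    using split sleq_join(1)[of j "p \<cdot> ?q"] j p q by simp
  have "j \<cdot> f y = \<zero>" if "y \<in> Y" for y
  proof -
    have fy: "f y \<in> carrier B" using Y that by auto
    show ?thesis
      by (rule disjoint_mono[OF j fy j q sleq_refl[OF j] sleq_fin_join[OF Y that] disj])
  qed
  then have jm: "sleq B j ?m" using m_iff j by blast
  have "?m \<cdot> ?q = \<zero>"
    using meet_fin_join_eq_zero[OF Y m(1)] m_iff[OF m(1)] sleq_refl[OF m(1)] by blast
  then have "(p \<cdot> ?m) \<cdot> (p \<cdot> ?q) = \<zero>"
    using disjoint_mono[OF _ _ m(1) q] meet_sleq(2) p q m(1) by simp
  \<comment> \<open>Distribute over the splitting of \<open>p\<close> into \<open>j\<close> and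
    \<open>p \<cdot> ?q\<close>. The second piece is disjoint from \<open>p \<cdot> ?m\<close>, so
    \<open>p \<cdot> ?m\<close> lies below \<open>j\<close>.\<close>
  moreover have "(p \<cdot> ?m) \<cdot> p = ((p \<cdot> ?m) \<cdot> j) \<curlyvee> ((p \<cdot> ?m) \<cdot> (p \<cdot> ?q))"
    using meet_join_distrib[of "p \<cdot> ?m" j "p \<cdot> ?q"] split p q m(1) j by simp
  ultimately have "(p \<cdot> ?m) \<cdot> p = (p \<cdot> ?m) \<cdot> j"
    using p m(1) j by simp
  then have "sleq B (p \<cdot> ?m) j"
    using p m(1) meet_sleq(1)[OF p m(1)] by (simp add: sleq_iff)
  moreover have "sleq B j (p \<cdot> ?m)"
    using jp jm p m(1) j by (simp add: sleq_meet_iff)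
  ultimately show ?thesis
    using p m(1) j by (simp add: sleq_antisym)
qed

end

section \<open>Subalgebras and ideals\<close>

lemma fin_join_subalgebra:
  assumes "generalized_boolean_algebra B" "generalized_boolean_algebra C"
    and sub: "carrier C \<subseteq> carrier B" and zero: "szero C = szero B"
    and join: "\<And>a b. a \<in> carrier C \<Longrightarrow> b \<in> carrier C \<Longrightarrow> sjoin C a b = sjoin B a b"
    and Z: "finite Z" "f \<in> Z \<rightarrow> carrier C"
  shows "fin_join C f Z = fin_join B f Z"
proof -
  interpret B: generalized_boolean_algebra B by fact
  interpret C: generalized_boolean_algebra C by fact
  \<comment> \<open>\<open>fin_join\<close> builds the carrier and the join into its monoid, and the
    two joins are known to agree only on \<open>carrier C\<close>. The products therefore live in
    different structures and are compared by induction on \<open>Z\<close>.\<close>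
  show ?thesis
    using Z
  proof (induction rule: finite_induct)
    case empty
    then show ?case by (simp add: zero)
  next
    case (insert x Z)
    then have "f x \<in> carrier C" "f \<in> Z \<rightarrow> carrier C" "f \<in> insert x Z \<rightarrow> carrier B"
      using sub by auto
    then show ?case
      using insert by (simp add: B.fin_join_insert C.fin_join_insert join flip: insert.IH)
  qed
qed

text \<open>The one existence axiom survives because a relative complement in \<open>b\<close> lies
  below \<open>b\<close>, hence in every down-closed set containing \<open>b\<close>. Closure under
  meets is also a case of down-closure.\<close>

lemma generalized_boolean_algebra_ideal:
  assumes "generalized_boolean_algebra B"
    and C: "carrier C \<subseteq> carrier B" "sprod C = sprod B" "szero C = szero B" "sjoin C = sjoin B"
    and zero: "szero B \<in> carrier C"
    and down: "\<And>a b. a \<in> carrier B \<Longrightarrow> b \<in> carrier C \<Longrightarrow> sleq B a b \<Longrightarrow> a \<in> carrier C"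
    and join: "\<And>a b. a \<in> carrier C \<Longrightarrow> b \<in> carrier C \<Longrightarrow> sjoin B a b \<in> carrier C"
  shows "generalized_boolean_algebra C"
proof -
  interpret generalized_boolean_algebra B by fact
  have CB: "a \<in> carrier B" if "a \<in> carrier C" for a using that C(1) by blast
  show ?thesis
  proof (unfold_locales, unfold C)
    fix a b assume ab: "a \<in> carrier C" "b \<in> carrier C"
    show "a \<cdot>\<^bsub>B\<^esub> b \<in> carrier C"
      using ab CB meet_sleq(2)[of a b] by (blast intro: down)
    assume "a = a \<cdot>\<^bsub>B\<^esub> b"
    then obtain x where x: "x \<in> carrier B" "x \<curlyvee>\<^bsub>B\<^esub> a = b" "x \<cdot>\<^bsub>B\<^esub> a = \<zero>\<^bsub>B\<^esub>"
      using ex_relcomp ab CB by meson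
    then have "x \<in> carrier C"
      using ab CB sleq_join(1)[of x a] down by metis
    then show "\<exists>x \<in> carrier C. x \<curlyvee>\<^bsub>B\<^esub> a = b \<and> x \<cdot>\<^bsub>B\<^esub> a = \<zero>\<^bsub>B\<^esub>"
      using x by blast
  qed (auto simp: CB intro: zero join meet_commute join_commute meet_assoc meet_join_distrib)
qed

section \<open>Tight and cover-to-join representations of semilattices\<close>

locale semilattice_zero =
  fixes E (structure)
  assumes closed: "x \<in> carrier E \<Longrightarrow> y \<in> carrier E \<Longrightarrow> x \<cdot> y \<in> carrier E"
    and zero: "\<zero> \<in> carrier E"
    and commute: "x \<in> carrier E \<Longrightarrow> y \<in> carrier E \<Longrightarrow> x \<cdot> y = y \<cdot> x"
    and assoc: "x \<in> carrier E \<Longrightarrow> y \<in> carrier E \<Longrightarrow> z \<in> carrier E \<Longrightarrow> (x \<cdot> y) \<cdot> z = x \<cdot> (y \<cdot> z)"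
    and idem: "x \<in> carrier E \<Longrightarrow> x \<cdot> x = x"
    and zero_prod: "x \<in> carrier E \<Longrightarrow> \<zero> \<cdot> x = \<zero>"

lemma (in semilattice_zero) sleq_prod_iff:
  assumes "x \<in> carrier E" "y \<in> carrier E" "z \<in> carrier E"
  shows "sleq E z (x \<cdot> y) \<longleftrightarrow> sleq E z x \<and> sleq E z y"
  unfolding sleq_iff using assms by (metis assoc closed commute idem)

text \<open>\<open>\<pi>\<close> is non-degenerate exactly when this set is all of
  \<open>carrier B\<close>.\<close>

definition rep_ideal ::
    "('a, 'm) semigroup_zero_scheme \<Rightarrow> ('b, 'n) gen_bool_scheme \<Rightarrow> ('a \<Rightarrow> 'b) \<Rightarrow> 'b set" where
  "rep_ideal E B \<pi> =
     {a \<in> carrier B. \<exists>Z. finite Z \<and> Z \<subseteq> carrier E \<and> sleq B a (fin_join B \<pi> Z)}"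

locale semilattice_zero_rep = E: semilattice_zero E + generalized_boolean_algebra B
  for E :: "('a, 'm) semigroup_zero_scheme" and B :: "('b, 'n) gen_bool_scheme" +
  fixes \<pi> :: "'a \<Rightarrow> 'b"
  assumes rep: "semilattice_rep E B \<pi>"
begin

lemma rep_closed: "x \<in> carrier E \<Longrightarrow> \<pi> x \<in> carrier B"
  and rep_zero: "\<pi> \<zero>\<^bsub>E\<^esub> = \<zero>\<^bsub>B\<^esub>"
  and rep_prod: "x \<in> carrier E \<Longrightarrow> y \<in> carrier E \<Longrightarrow> \<pi> (x \<cdot>\<^bsub>E\<^esub> y) = \<pi> x \<cdot>\<^bsub>B\<^esub> \<pi> y"
  using rep by (auto simp: semilattice_rep_def)

lemma rep_funcset: "Z \<subseteq> carrier E \<Longrightarrow> \<pi> \<in> Z \<rightarrow> carrier B"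
  using rep_closed by auto

section \<open>Images of finite covers\<close>

lemma fin_join_disjoint:
  assumes "finite Y" "Y \<subseteq> carrier E" "finite Z" "Z \<subseteq> below_perp E X Y"
  shows "fin_join B \<pi> Z \<cdot>\<^bsub>B\<^esub> fin_join B \<pi> Y = \<zero>\<^bsub>B\<^esub>"
proof -
  have Z: "\<pi> \<in> Z \<rightarrow> carrier B" and Y: "\<pi> \<in> Y \<rightarrow> carrier B"
    using assms by (auto simp: below_perp_def intro: rep_closed)
  \<comment> \<open>Each \<open>z\<close> is orthogonal to each \<open>y\<close>, and
    \<open>\<pi>\<close> preserves products and zero. Distributivity lifts this first to the join
    over \<open>Y\<close>, then to the join over \<open>Z\<close>.\<close>
  have "fin_join B \<pi> Y \<cdot>\<^bsub>B\<^esub> \<pi> z = \<zero>\<^bsub>B\<^esub>" if "z \<in> Z" for z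
  proof -
    have z: "z \<in> carrier E" "\<And>y. y \<in> Y \<Longrightarrow> z \<cdot>\<^bsub>E\<^esub> y = \<zero>\<^bsub>E\<^esub>"
      using that assms by (auto simp: below_perp_def)
    have "\<pi> z \<cdot>\<^bsub>B\<^esub> fin_join B \<pi> Y = \<zero>\<^bsub>B\<^esub>"
      using z assms(1,2) Y rep_closed
      by (intro meet_fin_join_eq_zero) (auto simp: rep_zero simp flip: rep_prod)
    then show ?thesis
      using z Y rep_closed meet_commute by simp
  qed
  then have "fin_join B \<pi> Y \<cdot>\<^bsub>B\<^esub> fin_join B \<pi> Z = \<zero>\<^bsub>B\<^esub>"
    using assms Z Y by (intro meet_fin_join_eq_zero) auto
  then show ?thesis using Z Y meet_commute by simp
qed

text \<open>Together with \<open>fin_join_disjoint\<close> this exhibits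
  \<open>fin_join B \<pi> Z\<close> as a relative complement in \<open>\<pi> x\<close>, from which
  both alternatives of tightness are read off when \<open>X\<close> is nonempty.\<close>

lemma cover_to_join_split:
  assumes c2j: "cover_to_join_rep E B \<pi>" and x: "x \<in> carrier E"
    and Y: "finite Y" "Y \<subseteq> carrier E" and Z: "finite_cover E (below_perp E {x} Y) Z"
  shows "fin_join B \<pi> Z \<curlyvee>\<^bsub>B\<^esub> (\<pi> x \<cdot>\<^bsub>B\<^esub> fin_join B \<pi> Y) = \<pi> x"
proof -
  let ?W = "Z \<union> (\<lambda>y. x \<cdot>\<^bsub>E\<^esub> y) ` Y"
  have finZ: "finite Z" and Zb: "Z \<subseteq> below_perp E {x} Y"
    using Z by (auto simp: finite_cover_def)
  then have ZE: "Z \<subseteq> carrier E" by (auto simp: below_perp_def)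
  have xy: "x \<cdot>\<^bsub>E\<^esub> y \<in> carrier E" "sleq E (x \<cdot>\<^bsub>E\<^esub> y) x" if "y \<in> carrier E" for y
    using x that E.sleq_prod_iff[OF x that, of "x \<cdot>\<^bsub>E\<^esub> y"] E.closed E.idem
    by (auto simp: sleq_iff)
  have "finite_cover E {z \<in> carrier E. sleq E z x} ?W"
    unfolding finite_cover_def
  proof (intro conjI ballI impI)
    show "finite ?W" using Y finZ by simp
    show "?W \<subseteq> {z \<in> carrier E. sleq E z x}"
      using Zb xy Y by (auto simp: below_perp_def)
    fix w assume w: "w \<in> {z \<in> carrier E. sleq E z x}" "w \<noteq> \<zero>\<^bsub>E\<^esub>"
    show "\<exists>z \<in> ?W. z \<cdot>\<^bsub>E\<^esub> w \<noteq> \<zero>\<^bsub>E\<^esub>"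
    \<comment> \<open>Either \<open>w\<close> is orthogonal to all of \<open>Y\<close>, hence lies
      in the set covered by \<open>Z\<close>, or it meets some \<open>y\<close>; then it also meets
      the product of \<open>x\<close> and \<open>y\<close>, because \<open>w\<close> lies below
      \<open>x\<close>.\<close>
    proof (cases "\<forall>y \<in> Y. w \<cdot>\<^bsub>E\<^esub> y = \<zero>\<^bsub>E\<^esub>")
      case True
      then have "w \<in> below_perp E {x} Y" using w by (simp add: below_perp_def)
      then show ?thesis using Z w by (auto simp: finite_cover_def)
    next
      case False
      then obtain y where y: "y \<in> Y" "w \<cdot>\<^bsub>E\<^esub> y \<noteq> \<zero>\<^bsub>E\<^esub>" by blast
      then have yc: "y \<in> carrier E" using Y by auto
      have "(x \<cdot>\<^bsub>E\<^esub> y) \<cdot>\<^bsub>E\<^esub> w = w \<cdot>\<^bsub>E\<^esub> (x \<cdot>\<^bsub>E\<^esub> y)"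
        using E.commute xy yc w by simp
      also have "\<dots> = w \<cdot>\<^bsub>E\<^esub> y"
        using w E.assoc[of w x y] x yc by (simp add: sleq_iff)
      finally show ?thesis using y by (metis UnI2 imageI)
    qed
  qed
  then have \<pi>x: "fin_join B \<pi> ?W = \<pi> x"
    using c2j x by (simp add: cover_to_join_rep_def)
  have W: "?W \<subseteq> carrier E" "finite ?W" using ZE xy Y finZ by auto
  have pf: "(\<lambda>y. \<pi> x \<cdot>\<^bsub>B\<^esub> \<pi> y) \<in> Y \<rightarrow> carrier B"
    using rep_closed x Y by auto
  \<comment> \<open>The map taking \<open>y\<close> to its product with \<open>x\<close> need not be
    injective on \<open>Y\<close>, and its image may overlap \<open>Z\<close>. Comparing upper
    bounds avoids both issues.\<close>
  have "fin_join B \<pi> Z \<curlyvee>\<^bsub>B\<^esub> fin_join B (\<lambda>y. \<pi> x \<cdot>\<^bsub>B\<^esub> \<pi> y) Y = fin_join B \<pi> ?W"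
  proof (rule sleq_cong)
    fix w assume w: "w \<in> carrier B"
    have "\<pi> (x \<cdot>\<^bsub>E\<^esub> y) = \<pi> x \<cdot>\<^bsub>B\<^esub> \<pi> y" if "y \<in> Y" for y
      using rep_prod x Y that by auto
    then show "sleq B (fin_join B \<pi> Z \<curlyvee>\<^bsub>B\<^esub> fin_join B (\<lambda>y. \<pi> x \<cdot>\<^bsub>B\<^esub> \<pi> y) Y) w \<longleftrightarrow>
        sleq B (fin_join B \<pi> ?W) w"
      using w pf rep_funcset[OF ZE] rep_funcset[OF W(1)] W(2) finZ Y(1)
      by (simp add: join_sleq_iff fin_join_sleq_iff ball_Un)
  qed (use pf rep_funcset[OF ZE] rep_funcset[OF W(1)] in auto)
  then show ?thesis
    using \<pi>x meet_fin_join_distrib[OF Y(1) rep_funcset[OF Y(2)] rep_closed[OF x]] by simp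
qed

text \<open>For each \<open>v\<close>, the products of \<open>v\<close> with the members of
  \<open>W\<close> cover the elements below \<open>v\<close>, so \<open>\<pi> v\<close> is a join of
  elements below \<open>fin_join B \<pi> W\<close>. Non-degeneracy carries this bound from the
  values of \<open>\<pi>\<close> to all of \<open>B\<close>.\<close>

lemma finite_cover_unit:
  assumes c2j: "cover_to_join_rep E B \<pi>" and nd: "non_degenerate_rep E B \<pi>"
    and W: "finite_cover E (carrier E) W"
  shows "is_unit B (fin_join B \<pi> W)"
proof -
  have fW: "finite W" and WE: "W \<subseteq> carrier E" using W by (auto simp: finite_cover_def)
  let ?u = "fin_join B \<pi> W"
  have u: "?u \<in> carrier B" using rep_funcset[OF WE] by simp
  have below: "sleq B (\<pi> v) ?u" if v: "v \<in> carrier E" for v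
  proof -
    let ?V = "(\<lambda>w. w \<cdot>\<^bsub>E\<^esub> v) ` W"
    have VE: "?V \<subseteq> carrier E" using WE v E.closed by auto
    have "finite_cover E {z \<in> carrier E. sleq E z v} ?V"
      unfolding finite_cover_def
    proof (intro conjI ballI impI)
      show "finite ?V" using fW by simp
      show "?V \<subseteq> {z \<in> carrier E. sleq E z v}"
        using WE v E.closed E.assoc E.idem by (auto simp: sleq_iff subset_iff)
      fix t assume t: "t \<in> {z \<in> carrier E. sleq E z v}" "t \<noteq> \<zero>\<^bsub>E\<^esub>"
      then obtain w where w: "w \<in> W" "w \<cdot>\<^bsub>E\<^esub> t \<noteq> \<zero>\<^bsub>E\<^esub>"
        using W by (auto simp: finite_cover_def)
      have "(w \<cdot>\<^bsub>E\<^esub> v) \<cdot>\<^bsub>E\<^esub> t = w \<cdot>\<^bsub>E\<^esub> t"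
        using w(1) WE t v E.assoc[of w v t] E.commute[of t v] by (auto simp: sleq_iff)
      then show "\<exists>z \<in> ?V. z \<cdot>\<^bsub>E\<^esub> t \<noteq> \<zero>\<^bsub>E\<^esub>"
        using w by (intro bexI[of _ "w \<cdot>\<^bsub>E\<^esub> v"]) auto
    qed
    then have "fin_join B \<pi> ?V = \<pi> v"
      using c2j v by (simp add: cover_to_join_rep_def)
    moreover have "sleq B (\<pi> (w \<cdot>\<^bsub>E\<^esub> v)) ?u" if "w \<in> W" for w
    proof -
      have wc: "w \<in> carrier E" using that WE by auto
      show ?thesis
        using sleq_trans[of "\<pi> w \<cdot>\<^bsub>B\<^esub> \<pi> v" "\<pi> w" ?u] meet_sleq(1)[of "\<pi> w" "\<pi> v"]
          sleq_fin_join[OF fW rep_funcset[OF WE] that] rep_closed wc v u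
        by (simp add: rep_prod)
    qed
    ultimately show ?thesis
      using fin_join_sleq_iff[OF _ rep_funcset[OF VE] u] fW by auto
  qed
  have "a \<cdot>\<^bsub>B\<^esub> ?u = a" if a: "a \<in> carrier B" for a
  proof -
    obtain V where V: "finite V" "V \<subseteq> carrier E" "sleq B a (fin_join B \<pi> V)"
      using nd a by (auto simp: non_degenerate_rep_def)
    have "sleq B (fin_join B \<pi> V) ?u"
      using fin_join_sleq_iff[OF V(1) rep_funcset[OF V(2)] u] below V(2) by auto
    then have "sleq B a ?u"
      using sleq_trans[OF a _ u V(3)] rep_funcset[OF V(2)] by simp
    then show ?thesis by (simp add: sleq_iff)
  qed
  then show ?thesis using u by (simp add: is_unit_def)
qed

text \<open>Reduces a nonempty finite \<open>X\<close> to a single element, its meet in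
  \<open>E\<close>. The induction carries the universal properties of \<open>x\<close> in
  \<open>E\<close> and of \<open>\<pi> x\<close> in \<open>B\<close> together, so no finite meet
  operation on \<open>E\<close> is required.\<close>

lemma finite_meet:
  assumes "finite X" "X \<noteq> {}" "X \<subseteq> carrier E"
  obtains x where "x \<in> carrier E" "\<And>Y. below_perp E X Y = below_perp E {x} Y" "fin_meet B \<pi> X = \<pi> x"
proof -
  have "X \<subseteq> carrier E \<longrightarrow> (\<exists>x \<in> carrier E.
      (\<forall>z \<in> carrier E. sleq E z x \<longleftrightarrow> (\<forall>x' \<in> X. sleq E z x')) \<and>
      (\<forall>w \<in> carrier B. sleq B w (\<pi> x) \<longleftrightarrow> (\<forall>x' \<in> X. sleq B w (\<pi> x'))))"
    using assms(1,2)
  proof (induction rule: finite_ne_induct)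
    case (singleton x)
    then show ?case by auto
  next
    case (insert y X)
    show ?case
    proof
      assume yX: "insert y X \<subseteq> carrier E"
      then obtain x where x: "x \<in> carrier E"
        "\<forall>z \<in> carrier E. sleq E z x \<longleftrightarrow> (\<forall>x' \<in> X. sleq E z x')"
        "\<forall>w \<in> carrier B. sleq B w (\<pi> x) \<longleftrightarrow> (\<forall>x' \<in> X. sleq B w (\<pi> x'))"
        using insert.IH by auto
      have y: "y \<in> carrier E" using yX by simp
      show "\<exists>x \<in> carrier E.
          (\<forall>z \<in> carrier E. sleq E z x \<longleftrightarrow> (\<forall>x' \<in> insert y X. sleq E z x')) \<and>
          (\<forall>w \<in> carrier B. sleq B w (\<pi> x) \<longleftrightarrow> (\<forall>x' \<in> insert y X. sleq B w (\<pi> x')))"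
        by (rule bexI[of _ "y \<cdot>\<^bsub>E\<^esub> x"])
          (use x y E.closed in \<open>auto simp: E.sleq_prod_iff sleq_meet_iff rep_prod rep_closed\<close>)
    qed
  qed
  then obtain x where x: "x \<in> carrier E"
      "\<forall>z \<in> carrier E. sleq E z x \<longleftrightarrow> (\<forall>x' \<in> X. sleq E z x')"
      "\<forall>w \<in> carrier B. sleq B w (\<pi> x) \<longleftrightarrow> (\<forall>x' \<in> X. sleq B w (\<pi> x'))"
    using assms(3) by blast
  show thesis
  proof
    show "x \<in> carrier E" by fact
    show "below_perp E X Y = below_perp E {x} Y" for Y
      using x(2) by (auto simp: below_perp_def)
    show "fin_meet B \<pi> X = \<pi> x"
      using assms x(3) rep_closed[OF x(1)] rep_funcset by (intro fin_meet_eqI) auto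
  qed
qed

section \<open>Comparison of tight and cover-to-join representations\<close>

lemma tight_imp_cover_to_join:
  assumes "tight_rep E B \<pi>"
  shows "cover_to_join_rep E B \<pi>"
  unfolding cover_to_join_rep_def
proof (intro conjI rep ballI allI impI)
  fix x Z assume x: "x \<in> carrier E" and Z: "finite_cover E {z \<in> carrier E. sleq E z x} Z"
  \<comment> \<open>Tightness is used with \<open>X = {x}\<close> and \<open>Y = {}\<close>. Its
    right-hand side is then \<open>\<pi> x\<close> met with the empty meet, which is the unit, or
    \<open>\<pi> x\<close> with zero removed.\<close>
  have Z': "finite_cover E (below_perp E {x} {}) Z"
    using Z by (simp add: below_perp_def)
  have px: "\<pi> x \<in> carrier B" using x by (rule rep_closed)
  have m: "fin_meet B \<pi> {x} = \<pi> x" using px by (rule fin_meet_singleton)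
  have z: "\<pi> x \<cdot>\<^bsub>B\<^esub> \<zero>\<^bsub>B\<^esub> = \<zero>\<^bsub>B\<^esub>" using px by (rule meet_zero)
  have XYZ: "finite {x} \<and> {x} \<subseteq> carrier E \<and> finite {} \<and> {} \<subseteq> carrier E \<and>
      finite_cover E (below_perp E {x} {}) Z"
    using Z' x by simp
  consider
    (unital) "boolean_alg B"
      "fin_join B \<pi> Z = fin_meet B \<pi> {x} \<cdot>\<^bsub>B\<^esub> fin_meet B (\<lambda>y. neg B (\<pi> y)) {}"
    | (non_unital) "fin_join B \<pi> Z =
        relcomp B (fin_meet B \<pi> {x}) (fin_meet B \<pi> {x} \<cdot>\<^bsub>B\<^esub> fin_join B \<pi> {})"
    using assms XYZ unfolding tight_rep_def by blast
  then show "fin_join B \<pi> Z = \<pi> x"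
  proof cases
    case unital
    then obtain u where u: "is_unit B u" by (auto simp: boolean_alg_def)
    then show ?thesis
      using unital px m by (simp add: fin_meet_empty) (simp add: is_unit_def)
  next
    case non_unital
    then show ?thesis using px z m by (simp add: relcomp_eqI)
  qed
qed

text \<open>Whether \<open>E\<close> has a finite cover decides the alternative: a finite cover
  yields a unit of \<open>B\<close>, and its absence forces \<open>X\<close> to be nonempty.\<close>

lemma cover_to_join_imp_tight:
  assumes c2j: "cover_to_join_rep E B \<pi>" and nd: "non_degenerate_rep E B \<pi>"
  shows "tight_rep E B \<pi>"
proof (cases "\<exists>W. finite_cover E (carrier E) W")
  case True
  then obtain u where u: "is_unit B u" using finite_cover_unit[OF c2j nd] by blast
  have "fin_join B \<pi> Z = fin_meet B \<pi> X \<cdot>\<^bsub>B\<^esub> fin_meet B (\<lambda>y. neg B (\<pi> y)) Y"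
    if X: "finite X" "X \<subseteq> carrier E" and Y: "finite Y" "Y \<subseteq> carrier E"
      and Z: "finite_cover E (below_perp E X Y) Z" for X Y Z
  proof -
    have finZ: "finite Z" and Zb: "Z \<subseteq> below_perp E X Y"
      using Z by (auto simp: finite_cover_def)
    then have ZE: "Z \<subseteq> carrier E" by (auto simp: below_perp_def)
    note disj = fin_join_disjoint[OF Y finZ Zb]
    have j: "fin_join B \<pi> Z \<in> carrier B" and q: "fin_join B \<pi> Y \<in> carrier B"
      using rep_funcset ZE Y by simp_all
    have "fin_meet B \<pi> X \<in> carrier B \<and>
        fin_join B \<pi> Z \<curlyvee>\<^bsub>B\<^esub> (fin_meet B \<pi> X \<cdot>\<^bsub>B\<^esub> fin_join B \<pi> Y) = fin_meet B \<pi> X"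
    proof (cases "X = {}")
      case True
      \<comment> \<open>With \<open>X\<close> empty the meet over \<open>X\<close> is the unit. The
        finite cover obtained here identifies that unit with the join of the images of
        \<open>Y\<close> and \<open>Z\<close>, which is the required splitting.\<close>
      then have "finite_cover E (carrier E) (Y \<union> Z)"
        using finite_cover_below_perp_empty[OF Y, of Z] Z E.commute by blast
      then have "is_unit B (fin_join B \<pi> (Y \<union> Z))"
        by (rule finite_cover_unit[OF c2j nd])
      moreover have "fin_join B \<pi> (Y \<union> Z) = fin_join B \<pi> Z \<curlyvee>\<^bsub>B\<^esub> fin_join B \<pi> Y"
        using Y finZ ZE j q join_commute by (simp add: fin_join_Un rep_funcset)
      ultimately have "is_unit B (fin_join B \<pi> Z \<curlyvee>\<^bsub>B\<^esub> fin_join B \<pi> Y)" by simp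
      then show ?thesis
        using True q meet_commute by (metis fin_meet_empty is_unit_def)
    next
      case False
      then obtain x where "x \<in> carrier E" "\<And>Y. below_perp E X Y = below_perp E {x} Y"
          "fin_meet B \<pi> X = \<pi> x"
        using finite_meet X by metis
      then show ?thesis using cover_to_join_split[OF c2j _ Y] Z rep_closed by simp
    qed
    then show ?thesis
      using meet_fin_meet_neg[OF u Y(1) rep_funcset[OF Y(2)] _ j _ disj] by simp
  qed
  then show ?thesis
    using u rep generalized_boolean_algebra_axioms unfolding tight_rep_def boolean_alg_def by blast
next
  case False
  have "fin_join B \<pi> Z = relcomp B (fin_meet B \<pi> X) (fin_meet B \<pi> X \<cdot>\<^bsub>B\<^esub> fin_join B \<pi> Y)"
    if X: "finite X" "X \<subseteq> carrier E" and Y: "finite Y" "Y \<subseteq> carrier E"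
      and Z: "finite_cover E (below_perp E X Y) Z" for X Y Z
  proof -
    have finZ: "finite Z" and Zb: "Z \<subseteq> below_perp E X Y"
      using Z by (auto simp: finite_cover_def)
    then have ZE: "Z \<subseteq> carrier E" by (auto simp: below_perp_def)
    have j: "fin_join B \<pi> Z \<in> carrier B" and q: "fin_join B \<pi> Y \<in> carrier B"
      using rep_funcset ZE Y by simp_all
    \<comment> \<open>Otherwise \<open>Y \<union> Z\<close> would be a finite cover for
      \<open>E\<close>.\<close>
    have "X \<noteq> {}"
      using finite_cover_below_perp_empty[OF Y, of Z] Z E.commute False by blast
    then obtain x where x: "x \<in> carrier E" "\<And>Y. below_perp E X Y = below_perp E {x} Y"
        "fin_meet B \<pi> X = \<pi> x"
      using finite_meet X by metis
    have px: "\<pi> x \<in> carrier B" using rep_closed x by simp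
    have "fin_join B \<pi> Z \<cdot>\<^bsub>B\<^esub> (\<pi> x \<cdot>\<^bsub>B\<^esub> fin_join B \<pi> Y) = \<zero>\<^bsub>B\<^esub>"
      using disjoint_mono[OF j _ j q sleq_refl[OF j] _ fin_join_disjoint[OF Y finZ Zb]]
        meet_sleq(2) px q by simp
    then show ?thesis
      using cover_to_join_split[OF c2j x(1) Y] Z x(2,3) j q px by (simp add: relcomp_eqI)
  qed
  then show ?thesis using rep False unfolding tight_rep_def by blast
qed

section \<open>The ideal generated by the range\<close>

lemma zero_in_rep_ideal: "\<zero>\<^bsub>B\<^esub> \<in> rep_ideal E B \<pi>"
  unfolding rep_ideal_def using sleq_refl[of "\<zero>\<^bsub>B\<^esub>"] by (auto intro!: exI[of _ "{}"])

lemma rep_in_rep_ideal: "x \<in> carrier E \<Longrightarrow> \<pi> x \<in> rep_ideal E B \<pi>"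
  unfolding rep_ideal_def using sleq_fin_join[of "{x}" \<pi> x] rep_closed
  by (auto intro!: exI[of _ "{x}"])

lemma rep_ideal_down:
  assumes a: "a \<in> carrier B" and b: "b \<in> rep_ideal E B \<pi>" and ab: "sleq B a b"
  shows "a \<in> rep_ideal E B \<pi>"
proof -
  obtain Z where Z: "finite Z" "Z \<subseteq> carrier E" "sleq B b (fin_join B \<pi> Z)" and bc: "b \<in> carrier B"
    using b by (auto simp: rep_ideal_def)
  have "sleq B a (fin_join B \<pi> Z)"
    using sleq_trans[OF a bc _ ab Z(3)] rep_funcset[OF Z(2)] by simp
  then show ?thesis using a Z by (auto simp: rep_ideal_def)
qed

lemma rep_ideal_join:
  assumes "a \<in> rep_ideal E B \<pi>" "b \<in> rep_ideal E B \<pi>"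
  shows "a \<curlyvee>\<^bsub>B\<^esub> b \<in> rep_ideal E B \<pi>"
proof -
  obtain Y Z where Y: "finite Y" "Y \<subseteq> carrier E" "sleq B a (fin_join B \<pi> Y)"
    and Z: "finite Z" "Z \<subseteq> carrier E" "sleq B b (fin_join B \<pi> Z)"
    and ab: "a \<in> carrier B" "b \<in> carrier B"
    using assms by (auto simp: rep_ideal_def)
  let ?y = "fin_join B \<pi> Y" and ?z = "fin_join B \<pi> Z"
  have yz: "?y \<in> carrier B" "?z \<in> carrier B"
    using rep_funcset Y Z by simp_all
  have "fin_join B \<pi> (Y \<union> Z) = ?y \<curlyvee>\<^bsub>B\<^esub> ?z"
    using Y Z by (simp add: fin_join_Un rep_funcset)
  moreover have "sleq B a (?y \<curlyvee>\<^bsub>B\<^esub> ?z)" "sleq B b (?y \<curlyvee>\<^bsub>B\<^esub> ?z)"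
    using sleq_trans[OF ab(1) yz(1) _ Y(3)] sleq_trans[OF ab(2) yz(2) _ Z(3)] sleq_join[OF yz] yz
    by simp_all
  ultimately have "sleq B (a \<curlyvee>\<^bsub>B\<^esub> b) (fin_join B \<pi> (Y \<union> Z))"
    using ab yz by (simp add: join_sleq_iff)
  moreover have "finite (Y \<union> Z)" "Y \<union> Z \<subseteq> carrier E"
    using Y Z by auto
  ultimately show ?thesis using ab unfolding rep_ideal_def by blast
qed

text \<open>Passing to the ideal makes \<open>\<pi>\<close> non-degenerate by construction, and
  finite joins of its values are the same in \<open>C\<close> as in \<open>B\<close>. The join of
  \<open>C\<close> is only required to agree on the carrier, since \<open>idem_algebra\<close>
  obtains its join by choice.\<close>

lemma cover_to_join_imp_tight_rep_ideal:
  assumes c2j: "cover_to_join_rep E B \<pi>"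
    and "generalized_boolean_algebra C"
    and C: "carrier C = rep_ideal E B \<pi>" "sprod C = sprod B" "szero C = szero B"
    and join: "\<And>a b. a \<in> carrier C \<Longrightarrow> b \<in> carrier C \<Longrightarrow> sjoin C a b = sjoin B a b"
  shows "tight_rep E C \<pi>"
proof -
  interpret C: generalized_boolean_algebra C by fact
  interpret C: semilattice_zero_rep E C \<pi>
    by unfold_locales
      (auto simp: semilattice_rep_def C rep_zero rep_prod intro: rep_in_rep_ideal)
  have sub: "carrier C \<subseteq> carrier B" by (auto simp: C rep_ideal_def)
  have join_eq: "fin_join C \<pi> Z = fin_join B \<pi> Z" if "finite Z" "Z \<subseteq> carrier E" for Z
    using fin_join_subalgebra[OF generalized_boolean_algebra_axioms assms(2) sub C(3) join that(1)]
      C.rep_funcset[OF that(2)] by blast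
  show ?thesis
  proof (rule C.cover_to_join_imp_tight)
    show "cover_to_join_rep E C \<pi>"
      unfolding cover_to_join_rep_def
    proof (intro conjI C.rep ballI allI impI)
      fix x Z assume "x \<in> carrier E" "finite_cover E {z \<in> carrier E. sleq E z x} Z"
      moreover from this have "finite Z" "Z \<subseteq> carrier E" by (auto simp: finite_cover_def)
      ultimately show "fin_join C \<pi> Z = \<pi> x"
        using c2j join_eq by (simp add: cover_to_join_rep_def)
    qed
    show "non_degenerate_rep E C \<pi>"
      unfolding non_degenerate_rep_def
    proof
      fix a assume "a \<in> carrier C"
      then obtain Z where Z: "finite Z" "Z \<subseteq> carrier E" "sleq B a (fin_join B \<pi> Z)"
        by (auto simp: C rep_ideal_def)
      then have "sleq C a (fin_join C \<pi> Z)"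
        using join_eq by (simp add: sleq_iff C)
      then show "\<exists>Z. finite Z \<and> Z \<subseteq> carrier E \<and> sleq C a (fin_join C \<pi> Z)"
        using Z by blast
    qed
  qed
qed

end

section \<open>Inverse semigroups\<close>

context inverse_semigroup
begin

section \<open>Inverses and commuting idempotents\<close>

lemma sinv:
  assumes "x \<in> carrier S"
  shows "sinv S x \<in> carrier S" "x \<cdot> sinv S x \<cdot> x = x" "sinv S x \<cdot> x \<cdot> sinv S x = sinv S x"
  using theI'[OF ex1_inverse[OF assms]] by (simp_all add: sinv_def)

lemma sinv_eqI:
  assumes "x \<in> carrier S" "y \<in> carrier S" "x \<cdot> y \<cdot> x = x" "y \<cdot> x \<cdot> y = y"
  shows "sinv S x = y"
  unfolding sinv_def by (rule the1_equality[OF ex1_inverse]) (use assms in auto)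

lemma idempotentD:
  assumes "e \<in> idempotents S"
  shows "e \<in> carrier S" "e \<cdot> e = e" "x \<in> carrier S \<Longrightarrow> e \<cdot> (e \<cdot> x) = e \<cdot> x"
  using assms prod_assoc[of e e x] by (auto simp: idempotents_def)

lemma sinv_idempotents:
  assumes x: "x \<in> carrier S"
  shows "x \<cdot> sinv S x \<in> idempotents S" "sinv S x \<cdot> x \<in> idempotents S"
  using sinv[OF x] x prod_assoc[of "x \<cdot> sinv S x" x "sinv S x"]
    prod_assoc[of "sinv S x \<cdot> x" "sinv S x" x]
  by (auto simp: idempotents_def)

text \<open>Let \<open>g\<close> be the inverse of \<open>e \<cdot> f\<close>. Then
  \<open>f \<cdot> g \<cdot> e\<close> is an inverse too, so uniqueness gives
  \<open>g = f \<cdot> g \<cdot> e\<close>, whence \<open>g\<close> is idempotent and its own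
  inverse. As \<open>e \<cdot> f\<close> is also an inverse of \<open>g\<close>, it equals
  \<open>g\<close>.\<close>

lemma idempotents_prod:
  assumes e: "e \<in> idempotents S" and f: "f \<in> idempotents S"
  shows "e \<cdot> f \<in> idempotents S"
proof -
  note ef = idempotentD[OF e] idempotentD[OF f]
  define g where "g = sinv S (e \<cdot> f)"
  have g: "g \<in> carrier S" "e \<cdot> (f \<cdot> (g \<cdot> (e \<cdot> f))) = e \<cdot> f" "g \<cdot> (e \<cdot> (f \<cdot> g)) = g"
    using sinv[of "e \<cdot> f"] ef by (simp_all add: g_def prod_assoc)
  \<comment> \<open>The last equation for \<open>g\<close> multiplied by \<open>e\<close>, in the
    right-nested form to which \<open>prod_assoc\<close> rewrites.\<close>
  have g': "g \<cdot> (e \<cdot> (f \<cdot> (g \<cdot> e))) = g \<cdot> e"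
  proof -
    have "g \<cdot> (e \<cdot> (f \<cdot> (g \<cdot> e))) = (g \<cdot> (e \<cdot> (f \<cdot> g))) \<cdot> e"
      using ef g(1) by (simp add: prod_assoc)
    then show ?thesis using g(3) by simp
  qed
  have "g = f \<cdot> g \<cdot> e"
    unfolding g_def
    by (rule sinv_eqI) (use ef g g' in \<open>simp_all add: prod_assoc flip: g_def\<close>)
  then have "g \<cdot> g = (f \<cdot> g \<cdot> e) \<cdot> (f \<cdot> g \<cdot> e)" by simp
  also have "\<dots> = f \<cdot> g \<cdot> e" using ef g g' by (simp add: prod_assoc)
  also have "\<dots> = g" using \<open>g = f \<cdot> g \<cdot> e\<close> by simp
  finally have gg: "g \<cdot> g = g" .
  have "sinv S g = g"
    by (rule sinv_eqI) (use g gg in auto)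
  moreover have "sinv S g = e \<cdot> f"
    by (rule sinv_eqI) (use g ef in \<open>simp_all add: prod_assoc\<close>)
  ultimately show ?thesis using gg g by (simp add: idempotents_def)
qed

text \<open>Products of idempotents being idempotent, both \<open>e \<cdot> f\<close> and
  \<open>f \<cdot> e\<close> are inverses of \<open>e \<cdot> f\<close>.\<close>

lemma idempotents_commute:
  assumes e: "e \<in> idempotents S" and f: "f \<in> idempotents S"
  shows "e \<cdot> f = f \<cdot> e"
proof -
  note ef = idempotentD[OF e] idempotentD[OF f]
  have ef2: "e \<cdot> (f \<cdot> (e \<cdot> f)) = e \<cdot> f" "f \<cdot> (e \<cdot> (f \<cdot> e)) = f \<cdot> e"
    using idempotentD(2)[OF idempotents_prod[OF e f]] idempotentD(2)[OF idempotents_prod[OF f e]] ef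
    by (simp_all add: prod_assoc)
  have "sinv S (e \<cdot> f) = f \<cdot> e"
    by (rule sinv_eqI) (use ef ef2 in \<open>simp_all add: prod_assoc\<close>)
  moreover have "sinv S (e \<cdot> f) = e \<cdot> f"
    by (rule sinv_eqI) (use ef ef2 in \<open>simp_all add: prod_assoc\<close>)
  ultimately show ?thesis by simp
qed

lemma zero_idempotent: "\<zero> \<in> idempotents S"
  by (simp add: idempotents_def)

lemma semilattice_zero_idem_semilattice: "semilattice_zero (idem_semilattice S)"
  by unfold_locales
    (auto simp: idem_semilattice_def idempotents_prod zero_idempotent prod_assoc idempotentD
      intro: idempotents_commute)

end

section \<open>Inverse subsemigroups and corners\<close>

lemma inverse_semigroup_inverse_subsemigroup:
  assumes "inverse_semigroup T" and H: "inverse_subsemigroup H T"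
  shows "inverse_semigroup (T\<lparr>carrier := H\<rparr>)"
proof -
  interpret inverse_semigroup T by fact
  have HT: "x \<in> carrier T" if "x \<in> H" for x
    using that H by (auto simp: inverse_subsemigroup_def)
  have "\<exists>!y. y \<in> H \<and> x \<cdot>\<^bsub>T\<^esub> y \<cdot>\<^bsub>T\<^esub> x = x \<and> y \<cdot>\<^bsub>T\<^esub> x \<cdot>\<^bsub>T\<^esub> y = y" if x: "x \<in> H" for x
  proof (rule ex1I[of _ "sinv T x"])
    show "sinv T x \<in> H \<and> x \<cdot>\<^bsub>T\<^esub> sinv T x \<cdot>\<^bsub>T\<^esub> x = x \<and> sinv T x \<cdot>\<^bsub>T\<^esub> x \<cdot>\<^bsub>T\<^esub> sinv T x = sinv T x"
      using x H HT sinv by (simp add: inverse_subsemigroup_def)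
    show "y = sinv T x" if "y \<in> H \<and> x \<cdot>\<^bsub>T\<^esub> y \<cdot>\<^bsub>T\<^esub> x = x \<and> y \<cdot>\<^bsub>T\<^esub> x \<cdot>\<^bsub>T\<^esub> y = y" for y
      using sinv_eqI[of x y] x that HT by simp
  qed
  then show ?thesis
    using H HT by (intro inverse_semigroup.intro) (simp_all add: inverse_subsemigroup_def prod_assoc)
qed

text \<open>For a set \<open>I\<close> of idempotents this is the union of the sets
  \<open>e T f\<close> with \<open>e\<close> and \<open>f\<close> in \<open>I\<close>. Separate
  idempotents on the two sides make closure under products immediate, without upper bounds in
  \<open>I\<close>.\<close>

definition corner :: "('a, 'm) semigroup_zero_scheme \<Rightarrow> 'a set \<Rightarrow> 'a set" where
  "corner T I = {t \<in> carrier T. \<exists>e \<in> I. \<exists>f \<in> I. e \<cdot>\<^bsub>T\<^esub> t = t \<and> t \<cdot>\<^bsub>T\<^esub> f = t}"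

lemma (in inverse_semigroup) inverse_subsemigroup_corner:
  assumes I: "I \<subseteq> idempotents S" "\<zero> \<in> I"
  shows "inverse_subsemigroup (corner S I) S"
  unfolding inverse_subsemigroup_def
proof (intro conjI ballI)
  show "corner S I \<subseteq> carrier S" by (auto simp: corner_def)
  show "\<zero> \<in> corner S I" using I by (auto simp: corner_def intro!: bexI[of _ \<zero>])
  fix s assume s: "s \<in> corner S I"
  then obtain e f where ef: "e \<in> I" "f \<in> I" "e \<cdot> s = s" "s \<cdot> f = s" and sc: "s \<in> carrier S"
    by (auto simp: corner_def)
  have c: "e \<in> carrier S" "f \<in> carrier S" "e \<cdot> e = e" "f \<cdot> f = f"
    using ef(1,2) I idempotentD by auto
  show "s \<cdot> t \<in> corner S I" if "t \<in> corner S I" for t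
  proof -
    obtain f' where t: "f' \<in> I" "t \<cdot> f' = t" "t \<in> carrier S"
      using \<open>t \<in> corner S I\<close> by (auto simp: corner_def)
    have "f' \<in> carrier S" using t(1) I idempotentD by auto
    then have "e \<cdot> (s \<cdot> t) = s \<cdot> t" "(s \<cdot> t) \<cdot> f' = s \<cdot> t"
      using prod_assoc[of e s t] prod_assoc[of s t f'] ef c t sc by simp_all
    then show ?thesis using ef t sc by (auto simp: corner_def)
  qed
  let ?r = "sinv S s"
  have r: "?r \<in> carrier S" using sinv sc by simp
  \<comment> \<open>The idempotents of \<open>s\<close> exchange sides:
    \<open>f \<cdot> ?r \<cdot> e\<close> is again an inverse of \<open>s\<close>, so it is
    \<open>?r\<close> by uniqueness.\<close>
  have "?r = f \<cdot> ?r \<cdot> e"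
  proof (rule sinv_eqI[OF sc])
    show "f \<cdot> ?r \<cdot> e \<in> carrier S" using c r by simp
    have "s \<cdot> (f \<cdot> ?r \<cdot> e) \<cdot> s = (s \<cdot> f) \<cdot> ?r \<cdot> (e \<cdot> s)"
      using c r sc by (simp add: prod_assoc)
    then show "s \<cdot> (f \<cdot> ?r \<cdot> e) \<cdot> s = s" using ef sinv[OF sc] by simp
    have "(f \<cdot> ?r \<cdot> e) \<cdot> s \<cdot> (f \<cdot> ?r \<cdot> e) = f \<cdot> (?r \<cdot> (e \<cdot> s) \<cdot> f \<cdot> ?r) \<cdot> e"
      using c r sc by (simp add: prod_assoc)
    also have "\<dots> = f \<cdot> (?r \<cdot> (s \<cdot> f) \<cdot> ?r) \<cdot> e"
      using c r sc ef(3) by (simp add: prod_assoc)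
    finally show "(f \<cdot> ?r \<cdot> e) \<cdot> s \<cdot> (f \<cdot> ?r \<cdot> e) = f \<cdot> ?r \<cdot> e"
      using ef sinv[OF sc] by simp
  qed
  moreover have "f \<cdot> (f \<cdot> ?r \<cdot> e) = f \<cdot> ?r \<cdot> e"
    using c r prod_assoc[of f f "?r \<cdot> e"] by (simp add: prod_assoc)
  moreover have "(f \<cdot> ?r \<cdot> e) \<cdot> e = f \<cdot> ?r \<cdot> e"
    using c r by (simp add: prod_assoc)
  ultimately have "f \<cdot> ?r = ?r" "?r \<cdot> e = ?r" by metis+
  then show "?r \<in> corner S I" using ef r by (auto simp: corner_def)
qed

text \<open>An idempotent of the corner is fixed by a member of \<open>I\<close>, hence lies below
  it; conversely a member of \<open>I\<close> fixes itself on both sides.\<close>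

lemma (in inverse_semigroup) idempotents_corner:
  assumes I: "I \<subseteq> idempotents S"
    and down: "\<And>g e. g \<in> idempotents S \<Longrightarrow> e \<in> I \<Longrightarrow> g \<cdot> e = g \<Longrightarrow> g \<in> I"
  shows "idempotents (S\<lparr>carrier := corner S I\<rparr>) = I"
proof
  show "idempotents (S\<lparr>carrier := corner S I\<rparr>) \<subseteq> I"
    using down by (auto simp: idempotents_def corner_def)
  show "I \<subseteq> idempotents (S\<lparr>carrier := corner S I\<rparr>)"
    using I by (fastforce simp: idempotents_def corner_def)
qed

text \<open>\<open>x\<close> is fixed on the left by \<open>x \<cdot> sinv S x\<close> and on the
  right by \<open>sinv S x \<cdot> x\<close>, and \<open>\<pi>\<close> sends both of these
  idempotents into \<open>I\<close>.\<close>

lemma semigroup_rep_in_corner: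
  assumes S: "inverse_semigroup S" and \<pi>: "semigroup_rep S T \<pi>"
    and I: "\<And>e. e \<in> idempotents S \<Longrightarrow> \<pi> e \<in> I" and x: "x \<in> carrier S"
  shows "\<pi> x \<in> corner T I"
proof -
  interpret inverse_semigroup S by fact
  note i = sinv_idempotents[OF x] and s = sinv[OF x]
  have "\<pi> (x \<cdot>\<^bsub>S\<^esub> sinv S x) \<cdot>\<^bsub>T\<^esub> \<pi> x = \<pi> (x \<cdot>\<^bsub>S\<^esub> sinv S x \<cdot>\<^bsub>S\<^esub> x)"
    "\<pi> x \<cdot>\<^bsub>T\<^esub> \<pi> (sinv S x \<cdot>\<^bsub>S\<^esub> x) = \<pi> (x \<cdot>\<^bsub>S\<^esub> (sinv S x \<cdot>\<^bsub>S\<^esub> x))"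
    using \<pi> x s(1) by (simp_all add: semigroup_rep_def)
  moreover have "x \<cdot>\<^bsub>S\<^esub> (sinv S x \<cdot>\<^bsub>S\<^esub> x) = x"
    using s x by (simp add: prod_assoc)
  moreover have "\<pi> x \<in> carrier T"
    using \<pi> x by (auto simp: semigroup_rep_def)
  ultimately show ?thesis
    using I[OF i(1)] I[OF i(2)] s(2) by (auto simp: corner_def)
qed

section \<open>Restriction of the target semigroup\<close>

lemma idem_algebra_simps [simp]:
  "carrier (idem_algebra T) = idempotents T"
  "sprod (idem_algebra T) = sprod T"
  "szero (idem_algebra T) = szero T"
  by (simp_all add: idem_algebra_def idem_with_join_def)

lemma generalized_boolean_algebra_idem_algebra:
  "generalized_boolean_inverse_semigroup T \<Longrightarrow> generalized_boolean_algebra (idem_algebra T)"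
  unfolding generalized_boolean_inverse_semigroup_def idem_algebra_def by (metis someI_ex)

lemma semilattice_zero_rep_idempotents:
  assumes S: "inverse_semigroup S" and T: "generalized_boolean_inverse_semigroup T"
    and \<pi>: "semigroup_rep S T \<pi>"
  shows "semilattice_zero_rep (idem_semilattice S) (idem_algebra T) \<pi>"
proof -
  have "semilattice_rep (idem_semilattice S) (idem_algebra T) \<pi>"
    using \<pi> unfolding semilattice_rep_def semigroup_rep_def
    by (auto simp: idem_semilattice_def idempotents_def Pi_iff) (metis)
  then show ?thesis
    using inverse_semigroup.semilattice_zero_idem_semilattice[OF S]
      generalized_boolean_algebra_idem_algebra[OF T]
    by (simp add: semilattice_zero_rep_def semilattice_zero_rep_axioms_def)
qed

text \<open>The idempotents of the corner are exactly the ideal generated by the image of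
  \<open>idempotents S\<close>, so its idempotent algebra can serve as the algebra \<open>C\<close>
  of \<open>cover_to_join_imp_tight_rep_ideal\<close>.\<close>

lemma cover_to_join_imp_tight_corner:
  assumes S: "inverse_semigroup S" and T: "generalized_boolean_inverse_semigroup T"
    and c2j: "cover_to_join S T \<pi>"
  defines "H \<equiv> corner T (rep_ideal (idem_semilattice S) (idem_algebra T) \<pi>)"
  shows "generalized_boolean_inverse_subsemigroup H T" "\<pi> ` carrier S \<subseteq> H"
    "tight S (T\<lparr>carrier := H\<rparr>) \<pi>"
proof -
  let ?B = "idem_algebra T" and ?T' = "T\<lparr>carrier := H\<rparr>"
  let ?I = "rep_ideal (idem_semilattice S) ?B \<pi>"
  have \<pi>: "semigroup_rep S T \<pi>" and c2j': "cover_to_join_rep (idem_semilattice S) ?B \<pi>"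
    using c2j by (auto simp: cover_to_join_def)
  have T': "inverse_semigroup T"
    using T by (simp add: generalized_boolean_inverse_semigroup_def)
  interpret semilattice_zero_rep "idem_semilattice S" ?B \<pi>
    by (rule semilattice_zero_rep_idempotents[OF S T \<pi>])
  interpret T: inverse_semigroup T by (rule T')
  have I: "?I \<subseteq> idempotents T" "\<zero>\<^bsub>T\<^esub> \<in> ?I"
    using zero_in_rep_ideal by (auto simp: rep_ideal_def)
  have H: "inverse_subsemigroup H T"
    unfolding H_def by (rule T.inverse_subsemigroup_corner[OF I])
  have EH: "idempotents ?T' = ?I"
    unfolding H_def
    by (rule T.idempotents_corner[OF I(1)]) (use rep_ideal_down in \<open>auto simp: sleq_iff\<close>)
  \<comment> \<open>The join of \<open>?B\<close> serves as witness for the restricted semigroup,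
    since the ideal is closed under it.\<close>
  have join: "generalized_boolean_algebra (idem_with_join ?T' (sjoin ?B))"
    by (rule generalized_boolean_algebra_ideal[OF generalized_boolean_algebra_axioms])
      (use I EH rep_ideal_down rep_ideal_join in \<open>auto simp: idem_with_join_def\<close>)
  then have gbis: "generalized_boolean_inverse_semigroup ?T'"
    using inverse_semigroup_inverse_subsemigroup[OF T' H]
    by (auto simp: generalized_boolean_inverse_semigroup_def)
  then show "generalized_boolean_inverse_subsemigroup H T"
    using H by (simp add: generalized_boolean_inverse_subsemigroup_def)
  have \<pi>H: "\<pi> x \<in> H" if "x \<in> carrier S" for x
    unfolding H_def
    by (rule semigroup_rep_in_corner[OF S \<pi> rep_in_rep_ideal that])
      (simp add: idem_semilattice_def)
  then show "\<pi> ` carrier S \<subseteq> H" by auto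
  note C = generalized_boolean_algebra_idem_algebra[OF gbis]
  \<comment> \<open>The join chosen for \<open>?T'\<close> may differ from that of \<open>?B\<close>
    as a function, but the meet determines it on the ideal.\<close>
  have "sjoin (idem_algebra ?T') a b = sjoin ?B a b"
    if "a \<in> idempotents ?T'" "b \<in> idempotents ?T'" for a b
    using sjoin_unique[OF C[unfolded idem_algebra_def] join that]
    by (simp add: idem_algebra_def idem_with_join_def)
  then have "tight_rep (idem_semilattice S) (idem_algebra ?T') \<pi>"
    by (intro cover_to_join_imp_tight_rep_ideal[OF c2j' C]) (use EH in auto)
  moreover have "semigroup_rep S ?T' \<pi>"
    using \<pi> \<pi>H by (auto simp: semigroup_rep_def)
  ultimately show "tight S ?T' \<pi>"
    by (simp add: tight_def)
qed

theorem corollary5p2: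
  fixes S :: "('a, 'm) semigroup_zero_scheme"
    and T :: "('b, 'n) semigroup_zero_scheme"
    and \<pi> :: "'a \<Rightarrow> 'b"
  assumes "inverse_semigroup S"
    and "generalized_boolean_inverse_semigroup T"
    and "semigroup_rep S T \<pi>"
  shows "(tight S T \<pi> \<longrightarrow> cover_to_join S T \<pi>) \<and>
         (cover_to_join S T \<pi> \<longrightarrow>
            (\<exists>T'. generalized_boolean_inverse_subsemigroup T' T \<and> \<pi> ` carrier S \<subseteq> T' \<and>
                  tight S (T\<lparr>carrier := T'\<rparr>) \<pi>)) \<and>
         (cover_to_join S T \<pi> \<and>
            non_degenerate_rep (idem_semilattice S) (idem_algebra T) \<pi> \<longrightarrow> tight S T \<pi>)"
proof -
  interpret semilattice_zero_rep "idem_semilattice S" "idem_algebra T" \<pi>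
    by (rule semilattice_zero_rep_idempotents[OF assms])
  show ?thesis
    using cover_to_join_imp_tight_corner[OF assms(1,2)] tight_imp_cover_to_join
      cover_to_join_imp_tight assms(3)
    unfolding tight_def cover_to_join_def by blast
qed

end
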